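(* Let $K=\mathrm{diag}(K_{11},K_{22},K_{33})$ be a constant positive-definite diagonal matrix, $a>0$, $T>0$, and $\widehat u:[0,L_0]\to\mathbb R^3$ smooth. Consider the tendon-actuated Kirchhoff rod with energy $$E=\int_0^{L_0}\Big\{\tfrac12(u-\widehat u)\cdot K(u-\widehat u)+T\,\Lambda(u)\Big\}ds,\qquad \Lambda(u)=\sqrt{(1-a\,u^2)^2+(a\,u^3)^2},$$ where $u=(u^1,u^2,u^3)$ (superscripts on components of $u$ are indices) is defined by $R'=R\,u^\times$ with $R(s)\in SO(3)$. On the region where $\Lambda(u)>0$ put $\mathcal L_1=T\Lambda$, $m=K(u-\widehat u)$, $d_1=(1,0,0)^T$, $$l=\Big(0,\,-aT\,\frac{1-a\,u^2}{\Lambda},\,aT\,\frac{a\,u^3}{\Lambda}\Big)^T,$$ and let $L$ be the $3\times3$ matrix of second partial derivatives $L_{ij}=\partial^2\mathcal L_1/\partial u^i\partial u^j$. Then $$(I+K^{-1}L)^{-1}=I-\frac{1}{K_{22}K_{33}\,\mathcal L_1+l\cdot Kl}\,(d_1\times Kl)\otimes(d_1\times l),$$ and the equilibrium equations of the rod are $$\begin{cases}R'=R\,(\widehat u+K^{-1}m)^\times,\\[4pt] m'+u\times m=l\times u-\dfrac{\big((m+l)\times u+K\widehat u'\big)\cdot(d_1\times Kl)}{K_{22}K_{33}\,\mathcal L_1+l\cdot Kl}\,(d_1\times l),\end{cases}$$ with $u=\widehat u+K^{-1}m$ and $l$, $\mathcal L_1$ evaluated at this $u$.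
   Context: For $w\in\mathbb R^3$, $w^\times$ is the skew matrix with $w^\times v=w\times v$; for columns $x,y\in\mathbb R^3$, $x\otimes y=x\,y^T$; $'$ is $d/ds$. Here $L_0$ denotes the rod length (to distinguish it from the matrix $L$). The rod is unshearable and inextensible; $a$ is the offset of the tendon from the centreline along the first material director, $T$ the tendon tension, $\widehat u$ the reference curvature, and $\Lambda$ the length element of the tendon. Equilibrium equations: the Hamiltonian (equivalently Euler--Lagrange/Hamel) equations of $\mathcal L(u,s)=\tfrac12(u-\widehat u(s))\cdot K(u-\widehat u(s))+\mathcal L_1(u)$ on the extended tangent bundle of $SO(3)$ with left-invariant quasi-velocities $u$. That is, a curve $R(s)$ with $R'=R\,u^\times$ (staying where $\Lambda(u)>0$) is an equilibrium iff it is a critical point of $E$ among curves in $SO(3)$ under variations fixing the endpoints; equivalently $p=\partial\mathcal L/\partial u=m+l$ satisfies $p'=p\times u$. *)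

theory Defs
  imports "HOL-Analysis.Analysis"
begin

unbundle cross3_syntax

section \<open>Matrices and partial derivatives\<close>

definition hat :: "real^3 \<Rightarrow> real^3^3" where
  "hat w = matrix (\<lambda>v. w \<times> v)"

definition outer :: "real^3 \<Rightarrow> real^3 \<Rightarrow> real^3^3" where
  "outer x y = (\<chi> i j. x $ i * y $ j)"

definition d1 :: "real^3" where
  "d1 = vector [1, 0, 0]"

definition partial_deriv :: "3 \<Rightarrow> (real^3 \<Rightarrow> real) \<Rightarrow> real^3 \<Rightarrow> real" where
  "partial_deriv i f v = deriv (\<lambda>h. f (v + h *\<^sub>R axis i 1)) 0"

definition gradient :: "(real^3 \<Rightarrow> real) \<Rightarrow> real^3 \<Rightarrow> real^3" where
  "gradient f v = (\<chi> i. partial_deriv i f v)"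

definition hessian :: "(real^3 \<Rightarrow> real) \<Rightarrow> real^3 \<Rightarrow> real^3^3" where
  "hessian f v = (\<chi> i j. partial_deriv i (partial_deriv j f) v)"

section \<open>Regularity of curves\<close>

text \<open>Derivatives are taken within \<open>I\<close>, hence one-sided at the endpoints of a closed interval.\<close>

primrec Ck_on :: "nat \<Rightarrow> real set \<Rightarrow> (real \<Rightarrow> 'a::real_normed_vector) \<Rightarrow> bool" where
  "Ck_on 0 I f \<longleftrightarrow> continuous_on I f"
| "Ck_on (Suc k) I f \<longleftrightarrow>
     (\<exists>f'. (\<forall>s\<in>I. (f has_vector_derivative f' s) (at s within I)) \<and> Ck_on k I f')"

definition smooth_curve_on :: "real set \<Rightarrow> (real \<Rightarrow> 'a::real_normed_vector) \<Rightarrow> bool" where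
  "smooth_curve_on I f \<longleftrightarrow> (\<forall>k. Ck_on k I f)"

section \<open>The tendon-actuated rod\<close>

definition tendon_length :: "real \<Rightarrow> real^3 \<Rightarrow> real" where
  "tendon_length a v = sqrt ((1 - a * v $ 2)\<^sup>2 + (a * v $ 3)\<^sup>2)"

definition lagr1 :: "real \<Rightarrow> real \<Rightarrow> real^3 \<Rightarrow> real" where
  "lagr1 a T v = T * tendon_length a v"

definition lagr :: "real^3^3 \<Rightarrow> real \<Rightarrow> real \<Rightarrow> (real \<Rightarrow> real^3) \<Rightarrow> real^3 \<Rightarrow> real \<Rightarrow> real" where
  "lagr K a T uh v s = 1/2 * ((v - uh s) \<bullet> (K *v (v - uh s))) + lagr1 a T v"

definition lvec :: "real \<Rightarrow> real \<Rightarrow> real^3 \<Rightarrow> real^3" where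
  "lvec a T v = vector
     [0,
      - (a * T * ((1 - a * v $ 2) / tendon_length a v)),
      a * T * (a * v $ 3 / tendon_length a v)]"

text \<open>The quasi-velocity \<open>u\<close> of a differentiable curve in the rotation group.\<close>

definition strain :: "real \<Rightarrow> (real \<Rightarrow> real^3^3) \<Rightarrow> real \<Rightarrow> real^3" where
  "strain L0 R s = (THE w. (R has_vector_derivative R s ** hat w) (at s within {0..L0}))"

definition rod_energy ::
  "real^3^3 \<Rightarrow> real \<Rightarrow> real \<Rightarrow> (real \<Rightarrow> real^3) \<Rightarrow> real \<Rightarrow> (real \<Rightarrow> real^3^3) \<Rightarrow> real" where
  "rod_energy K a T uh L0 R = integral {0..L0} (\<lambda>s. lagr K a T uh (strain L0 R s) s)"

text \<open>Admissible configurations: \<open>C\<^sup>1\<close> curves in the rotation group along which the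
  length element of the tendon does not vanish.\<close>

definition rod_curve :: "real \<Rightarrow> real \<Rightarrow> (real \<Rightarrow> real^3^3) \<Rightarrow> bool" where
  "rod_curve a L0 R \<longleftrightarrow>
     (\<forall>s\<in>{0..L0}. rotation_matrix (R s)) \<and> Ck_on 1 {0..L0} R \<and>
     (\<forall>s\<in>{0..L0}. tendon_length a (strain L0 R s) > 0)"

text \<open>A variation of \<open>R\<close> with fixed endpoints: a \<open>C\<^sup>1\<close> family \<open>e \<mapsto> V e\<close> of \<open>C\<^sup>1\<close> curves in the
  rotation group. Here \<open>Vs\<close>, \<open>Ve\<close> and \<open>Ves\<close> are the partial derivatives in \<open>s\<close>, in \<open>e\<close>, and the
  mixed one.\<close>

definition variation_of :: "real \<Rightarrow> (real \<Rightarrow> real^3^3) \<Rightarrow> (real \<Rightarrow> real \<Rightarrow> real^3^3) \<Rightarrow> bool" where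
  "variation_of L0 R V \<longleftrightarrow>
     (\<forall>s\<in>{0..L0}. V 0 s = R s) \<and>
     (\<exists>r>0. \<exists>Vs Ve Ves.
        (\<forall>e\<in>{-r<..<r}. V e 0 = R 0 \<and> V e L0 = R L0) \<and>
        (\<forall>e\<in>{-r<..<r}. \<forall>s\<in>{0..L0}.
           rotation_matrix (V e s) \<and>
           (V e has_vector_derivative Vs e s) (at s within {0..L0}) \<and>
           ((\<lambda>e. V e s) has_vector_derivative Ve e s) (at e) \<and>
           ((\<lambda>e. Vs e s) has_vector_derivative Ves e s) (at e)) \<and>
        (\<forall>F\<in>{Vs, Ve, Ves}.
           continuous_on (Sigma {-r<..<r} (\<lambda>_. {0..L0})) (\<lambda>(e, s). F e s)))"

definition critical_curve ::
  "real^3^3 \<Rightarrow> real \<Rightarrow> real \<Rightarrow> (real \<Rightarrow> real^3) \<Rightarrow> real \<Rightarrow> (real \<Rightarrow> real^3^3) \<Rightarrow> bool" where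
  "critical_curve K a T uh L0 R \<longleftrightarrow>
     (\<forall>V. variation_of L0 R V \<longrightarrow>
        ((\<lambda>e. rod_energy K a T uh L0 (V e)) has_real_derivative 0) (at 0))"

text \<open>The Euler--Lagrange/Hamel equations \<open>p' = p \<times> u\<close> with \<open>p\<close> the derivative of the Lagrangian
  in the quasi-velocity.\<close>

definition hamel_equations ::
  "real^3^3 \<Rightarrow> real \<Rightarrow> real \<Rightarrow> (real \<Rightarrow> real^3) \<Rightarrow> real \<Rightarrow> (real \<Rightarrow> real^3^3) \<Rightarrow> bool" where
  "hamel_equations K a T uh L0 R \<longleftrightarrow>
     (let u = strain L0 R; p = (\<lambda>s. gradient (\<lambda>v. lagr K a T uh v s) (u s))
      in \<forall>s\<in>{0..L0}. (p has_vector_derivative (p s \<times> u s)) (at s within {0..L0}))"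

definition rod_system ::
  "real^3^3 \<Rightarrow> real \<Rightarrow> real \<Rightarrow> (real \<Rightarrow> real^3) \<Rightarrow> real \<Rightarrow> (real \<Rightarrow> real^3^3) \<Rightarrow> (real \<Rightarrow> real^3) \<Rightarrow> bool"
  where
  "rod_system K a T uh L0 R m \<longleftrightarrow>
     (\<forall>s\<in>{0..L0}.
        let u = uh s + matrix_inv K *v m s;
            l = lvec a T u;
            uh' = vector_derivative uh (at s within {0..L0})
        in (R has_vector_derivative R s ** hat u) (at s within {0..L0}) \<and>
           (\<exists>m'. (m has_vector_derivative m') (at s within {0..L0}) \<and>
              m' + u \<times> m s =
                l \<times> u -
                ((((m s + l) \<times> u + K *v uh') \<bullet> (d1 \<times> (K *v l))) /
                 (K $ 2 $ 2 * K $ 3 $ 3 * lagr1 a T u + l \<bullet> (K *v l))) *\<^sub>R (d1 \<times> l)))"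

end

theory Submission
  imports Defs
begin

text \<open>
  The Hessian of \<open>T \<Lambda>\<close> has rank one: it is \<open>y \<otimes> y / lagr1\<close> with \<open>y = d\<^sub>1 \<times> l\<close>, and
  \<open>K\<^sup>-\<^sup>1 y = d\<^sub>1 \<times> K l / (K\<^sub>2\<^sub>2 K\<^sub>3\<^sub>3)\<close>, so the inverse of \<open>I + K\<^sup>-\<^sup>1 L\<close> is given by the
  Sherman--Morrison formula.

  A variation \<open>V\<close> of \<open>R\<close> with infinitesimal rotation \<open>\<eta>\<close>, i.e. \<open>\<partial>V/\<partial>e = R \<eta>\<^sup>\<times>\<close> at \<open>e = 0\<close>, changes
  the strain by \<open>\<eta>' + u \<times> \<eta>\<close>, whence the first variation of the energy is
  \<open>\<integral> p \<bullet> (\<eta>' + u \<times> \<eta>)\<close>. If \<open>p' = p \<times> u\<close> the integrand is the derivative of \<open>p \<bullet> \<eta>\<close>, which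
  vanishes at the ends. Conversely, rotating \<open>R s\<close> by the angle \<open>e \<phi>(s)\<close> about a fixed coordinate
  axis realises \<open>\<eta> = \<phi> d\<^sub>i\<close>, and the lemma of du Bois-Reymond yields \<open>p' = p \<times> u\<close> although
  \<open>u\<close> is only known to be continuous.

  To pass from \<open>p\<close> to \<open>m\<close>, one needs \<open>u\<close> to be differentiable: it is continuous and
  \<open>p + K uh = K u + l(u)\<close> is differentiable, where \<open>u \<mapsto> K u + l(u)\<close> has the positive definite
  derivative \<open>K + L\<close>. Then \<open>(I + L K\<^sup>-\<^sup>1) m' = p \<times> u - L uh'\<close> is solved for \<open>m'\<close> by the same
  rank-one inversion.
\<close>

section \<open>Curves in the rotation group\<close>

lemma hat_entries:
  "hat w $ 1 $ 1 = 0" "hat w $ 1 $ 2 = - w $ 3" "hat w $ 1 $ 3 = w $ 2"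
  "hat w $ 2 $ 1 = w $ 3" "hat w $ 2 $ 2 = 0" "hat w $ 2 $ 3 = - w $ 1"
  "hat w $ 3 $ 1 = - w $ 2" "hat w $ 3 $ 2 = w $ 1" "hat w $ 3 $ 3 = 0"
  by (simp_all add: hat_def matrix_def cross_components axis_def)

lemmas matrix_3_simps =
  vec_eq_iff forall_3 sum_3 hat_entries matrix_matrix_mult_def transpose_def mat_def
  cross_components

text \<open>The axial vector of a skew matrix. Reading one fixed entry from each off-diagonal pair
  makes it linear on all matrices, so it commutes with differentiation before skewness is
  known.\<close>

definition vex :: "real^3^3 \<Rightarrow> real^3" where
  "vex M = vector [M $ 3 $ 2, M $ 1 $ 3, M $ 2 $ 1]"

lemma vex_hat [simp]: "vex (hat w) = w"
  by (simp add: vex_def matrix_3_simps)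

lemma hat_vex:
  assumes "transpose M = - M"
  shows "hat (vex M) = M"
proof -
  have skew: "M $ j $ i = - M $ i $ j" for i j
    using arg_cong[OF assms, of "\<lambda>A. A $ i $ j"] by (simp add: transpose_def)
  show ?thesis
    using skew[of 1 1] skew[of 2 2] skew[of 3 3] skew[of 1 2] skew[of 1 3] skew[of 2 3]
    by (simp add: vex_def matrix_3_simps)
qed

lemma transpose_hat: "transpose (hat w) = - hat w"
  by (simp add: matrix_3_simps)

text \<open>\<open>hat\<close> is a Lie algebra homomorphism into the skew matrices; this commutator
  is the source of the term \<open>u \<times> \<eta>\<close> in the variation of the strain.\<close>

lemma hat_cross: "hat (v \<times> w) = hat v ** hat w - hat w ** hat v"
  by (simp add: matrix_3_simps)

section \<open>Calculus rules for matrix-valued curves\<close>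

lemma bounded_linear_vex: "bounded_linear vex"
  by (rule linear_conv_bounded_linear[THEN iffD1])
     (simp add: linear_iff vex_def matrix_3_simps)

lemma bounded_linear_hat: "bounded_linear hat"
  by (rule linear_conv_bounded_linear[THEN iffD1])
     (simp add: linear_iff matrix_3_simps)

lemma bounded_linear_transpose: "bounded_linear (transpose :: real^'n^'m \<Rightarrow> real^'m^'n)"
  by (rule linear_conv_bounded_linear[THEN iffD1])
     (simp add: linear_iff transpose_def vec_eq_iff)

lemma bounded_bilinear_matrix_matrix_mult:
  "bounded_bilinear ((**) :: real^'n^'m \<Rightarrow> real^'p^'n \<Rightarrow> real^'p^'m)"
  by (rule bilinear_conv_bounded_bilinear[THEN iffD1])
     (simp add: bilinear_def linear_iff matrix_matrix_mult_def vec_eq_iff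
        sum.distrib sum_distrib_left distrib_left distrib_right mult_ac)

lemmas has_vector_derivative_matrix_mult [derivative_intros] =
  bounded_bilinear.has_vector_derivative [OF bounded_bilinear_matrix_matrix_mult]
lemmas has_vector_derivative_transpose [derivative_intros] =
  bounded_linear.has_vector_derivative [OF bounded_linear_transpose]
lemmas has_vector_derivative_vex [derivative_intros] =
  bounded_linear.has_vector_derivative [OF bounded_linear_vex]
lemmas continuous_on_matrix_mult [continuous_intros] =
  bounded_bilinear.continuous_on [OF bounded_bilinear_matrix_matrix_mult]
lemmas continuous_on_transpose [continuous_intros] =
  bounded_linear.continuous_on [OF bounded_linear_transpose]
lemmas continuous_on_vex [continuous_intros] =
  bounded_linear.continuous_on [OF bounded_linear_vex]

text \<open>Differentiating \<open>transpose (R s) ** R s = mat 1\<close> shows that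
  \<open>transpose (R s) ** D\<close> is skew. The set \<open>I\<close> is left general because the
  lemma is used in \<open>s\<close> on a closed interval, one-sidedly at the ends, and in
  \<open>e\<close> on an open one.\<close>

lemma orthogonal_curve_derivative:
  fixes R :: "real \<Rightarrow> real^3^3"
  assumes orth: "\<And>s. s \<in> I \<Longrightarrow> orthogonal_matrix (R s)" and s: "s \<in> I" "at s within I \<noteq> bot"
    and R': "(R has_vector_derivative D) (at s within I)"
  shows "D = R s ** hat (vex (transpose (R s) ** D))"
proof -
  have "((\<lambda>s. transpose (R s) ** R s) has_vector_derivative
      (transpose (R s) ** D + transpose D ** R s)) (at s within I)"
    by (rule derivative_intros R')+
  moreover have "((\<lambda>s. transpose (R s) ** R s) has_vector_derivative 0) (at s within I)"
    by (rule has_vector_derivative_transform[OF s(1) _ has_vector_derivative_const[of "mat 1"]])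
       (use orth in \<open>auto simp: orthogonal_matrix\<close>)
  ultimately have "transpose (R s) ** D + transpose D ** R s = 0"
    using vector_derivative_unique_within s(2) by blast
  then have "transpose (transpose (R s) ** D) = - (transpose (R s) ** D)"
    by (simp add: matrix_transpose_mul eq_neg_iff_add_eq_0 add.commute)
  then have "hat (vex (transpose (R s) ** D)) = transpose (R s) ** D"
    by (rule hat_vex)
  then show ?thesis
    using orth[OF s(1)] by (simp add: matrix_mul_assoc orthogonal_matrix_def)
qed

lemma at_within_Icc_neq_bot:
  fixes L0 :: real
  assumes "0 < L0" "s \<in> {0..L0}"
  shows "at s within {0..L0} \<noteq> bot"
  using islimpt_Icc[OF assms(1)] assms(2) unfolding trivial_limit_within by simp

text \<open>Justifies the definite description in \<open>strain\<close>: \<open>R s\<close> can be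
  cancelled and \<open>hat\<close> is injective.\<close>

lemma strain_unique:
  assumes "0 < L0" "s \<in> {0..L0}" "orthogonal_matrix (R s)"
    and "(R has_vector_derivative R s ** hat w) (at s within {0..L0})"
  shows "strain L0 R s = w"
proof -
  have "v = w" if "(R has_vector_derivative R s ** hat v) (at s within {0..L0})" for v
  proof -
    have "R s ** hat v = R s ** hat w"
      using vector_derivative_unique_within[OF at_within_Icc_neq_bot that assms(4)] assms by blast
    then have "transpose (R s) ** R s ** hat v = transpose (R s) ** R s ** hat w"
      by (simp flip: matrix_mul_assoc)
    then have "hat v = hat w"
      using assms(3) by (simp add: orthogonal_matrix_def)
    then show ?thesis using vex_hat[of v] by simp
  qed
  then show ?thesis
    unfolding strain_def using assms(4) by blast
qed

text \<open>Replaces the definite description by an explicit expression from which continuity and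
  derivatives can be read off.\<close>

lemma strain_eq_vex:
  assumes "0 < L0" "s \<in> {0..L0}" "\<And>s. s \<in> {0..L0} \<Longrightarrow> orthogonal_matrix (R s)"
    and "(R has_vector_derivative D) (at s within {0..L0})"
  shows "strain L0 R s = vex (transpose (R s) ** D)"
  using assms orthogonal_curve_derivative[OF assms(3,2) at_within_Icc_neq_bot assms(4)]
  by (intro strain_unique) auto

section \<open>Derivatives of the tendon energy\<close>

lemma tendon_length_squared: "(tendon_length a v)\<^sup>2 = (1 - a * v $ 2)\<^sup>2 + (a * v $ 3)\<^sup>2"
  by (simp add: tendon_length_def)

lemma lvec_components [simp]:
  "lvec a T v $ 1 = 0"
  "lvec a T v $ 2 = - (a * T * ((1 - a * v $ 2) / tendon_length a v))"
  "lvec a T v $ 3 = a * T * (a * v $ 3 / tendon_length a v)"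
  by (simp_all add: lvec_def)

lemma d1_cross_components [simp]:
  "(d1 \<times> v) $ 1 = 0" "(d1 \<times> v) $ 2 = - v $ 3" "(d1 \<times> v) $ 3 = v $ 2"
  by (simp_all add: cross_components d1_def)

lemma continuous_on_tendon_length [continuous_intros]:
  "continuous_on S f \<Longrightarrow> continuous_on S (\<lambda>x. tendon_length a (f x))"
  unfolding tendon_length_def by (intro continuous_intros)

lemma open_tendon_region: "open {v. 0 < tendon_length a v}"
  by (intro open_Collect_less continuous_intros)

lemma has_derivative_nth: "((\<lambda>w::real^'n. w $ i) has_derivative (\<lambda>h. h $ i)) F"
  by (rule bounded_linear_imp_has_derivative[OF bounded_linear_vec_nth])

lemma tendon_length_has_derivative:
  assumes "0 < tendon_length a v"
  shows "(tendon_length a has_derivative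
    (\<lambda>h. (- a * (1 - a * v $ 2) * h $ 2 + a * (a * v $ 3) * h $ 3) / tendon_length a v)) (at v)"
proof -
  have pos: "0 < (1 - a * v $ 2)\<^sup>2 + (a * v $ 3)\<^sup>2"
    using assms by (simp add: tendon_length_def)
  \<comment> \<open>The factor 2 from the squares cancels the one half in the derivative of the
    square root.\<close>
  have half: "2 * x * (inverse r / 2) = x / r" for x r :: real
    by (simp add: inverse_eq_divide)
  have "((\<lambda>w. (1 - a * w $ 2)\<^sup>2 + (a * w $ 3)\<^sup>2) has_derivative
      (\<lambda>h. 2 * (- a * (1 - a * v $ 2) * h $ 2 + a * (a * v $ 3) * h $ 3))) (at v)"
    by (auto intro!: derivative_eq_intros has_derivative_nth simp: algebra_simps power2_eq_square)
  from DERIV_compose_FDERIV[OF DERIV_real_sqrt[OF pos] this]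
  show ?thesis
    unfolding tendon_length_def[abs_def]
    by (rule has_derivative_eq_rhs) (simp only: half)
qed

lemma lagr1_has_derivative:
  assumes "0 < tendon_length a v"
  shows "(lagr1 a T has_derivative (\<lambda>h. lvec a T v \<bullet> h)) (at v)"
  unfolding lagr1_def[abs_def]
  by (rule has_derivative_eq_rhs[OF has_derivative_mult_right[OF tendon_length_has_derivative[OF assms]]])
     (simp add: fun_eq_iff inner_vec_def sum_3 add_divide_distrib diff_divide_distrib algebra_simps)

text \<open>Where the tendon length is positive, \<open>l\<close> has the constant length
  \<open>\<bar>a * T\<bar>\<close> and lies in the plane orthogonal to \<open>d1\<close>. It can
  therefore only turn in that plane, so its derivative is a multiple of
  \<open>y = d1 \<times> l\<close>.\<close>

lemma lvec_has_derivative: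
  fixes a T :: real
  assumes pos: "0 < tendon_length a v" and T: "T \<noteq> 0"
  defines "y \<equiv> d1 \<times> lvec a T v"
  shows "(lvec a T has_derivative (\<lambda>h. (y \<bullet> h / lagr1 a T v) *\<^sub>R y)) (at v)"
proof -
  define \<Lambda> P Q where "\<Lambda> = tendon_length a v" and "P = 1 - a * v $ 2" and "Q = a * v $ 3"
  have \<Lambda>: "\<Lambda> \<noteq> 0" and sq: "\<Lambda> * \<Lambda> = P * P + Q * Q"
    using pos tendon_length_squared[of a v] by (auto simp: \<Lambda>_def P_def Q_def power2_eq_square)
  note D = tendon_length_has_derivative[OF pos]
  have lvec_axis: "lvec a T = (\<lambda>w. (- (a * T * ((1 - a * w $ 2) / tendon_length a w))) *\<^sub>R axis 2 1
      + (a * T * (a * w $ 3 / tendon_length a w)) *\<^sub>R axis 3 1)"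
    by (simp add: fun_eq_iff vec_eq_iff forall_3 axis_def)
  \<comment> \<open>\<open>c2\<close> and \<open>c3\<close> rewrite the output of the quotient rule
    for the two nonzero components. The relation \<open>sq\<close> turns each numerator into
    \<open>Q\<close> or \<open>P\<close> times the common factor \<open>Q * h2 + P * h3\<close>,
    which is where rank one appears.\<close>
  have c2: "- (a * T * ((- (a * h2) * \<Lambda> - P * ((- a * P * h2 + a * Q * h3) / \<Lambda>)) / (\<Lambda> * \<Lambda>)))
      = (- (a * T * (Q / \<Lambda>)) * h2 - a * T * (P / \<Lambda>) * h3) / (T * \<Lambda>) * (- (a * T * (Q / \<Lambda>)))" for h2 h3
  proof -
    have "- (a * T * ((- (a * h2) * \<Lambda> - P * ((- a * P * h2 + a * Q * h3) / \<Lambda>)) / (\<Lambda> * \<Lambda>)))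
      = a * a * T * (h2 * (\<Lambda> * \<Lambda>) - P * P * h2 + P * Q * h3) / (\<Lambda> * \<Lambda> * \<Lambda>)"
      using \<Lambda> by (simp add: field_simps)
    also have "h2 * (\<Lambda> * \<Lambda>) - P * P * h2 + P * Q * h3 = Q * (Q * h2 + P * h3)"
      by (simp add: sq algebra_simps)
    finally show ?thesis
      using \<Lambda> T by (simp add: field_simps)
  qed
  have c3: "a * T * ((a * h3 * \<Lambda> - Q * ((- a * P * h2 + a * Q * h3) / \<Lambda>)) / (\<Lambda> * \<Lambda>))
      = (- (a * T * (Q / \<Lambda>)) * h2 - a * T * (P / \<Lambda>) * h3) / (T * \<Lambda>) * (- (a * T * (P / \<Lambda>)))" for h2 h3
  proof -
    have "a * T * ((a * h3 * \<Lambda> - Q * ((- a * P * h2 + a * Q * h3) / \<Lambda>)) / (\<Lambda> * \<Lambda>))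
      = a * a * T * (h3 * (\<Lambda> * \<Lambda>) - Q * Q * h3 + P * Q * h2) / (\<Lambda> * \<Lambda> * \<Lambda>)"
      using \<Lambda> by (simp add: field_simps)
    also have "h3 * (\<Lambda> * \<Lambda>) - Q * Q * h3 + P * Q * h2 = P * (Q * h2 + P * h3)"
      by (simp add: sq algebra_simps)
    finally show ?thesis
      using \<Lambda> T by (simp add: field_simps)
  qed
  have "(lvec a T has_derivative (\<lambda>h.
      (- (a * T * ((- (a * h $ 2) * \<Lambda> - P * ((- a * P * h $ 2 + a * Q * h $ 3) / \<Lambda>)) / (\<Lambda> * \<Lambda>)))) *\<^sub>R axis 2 1 +
      (a * T * ((a * h $ 3 * \<Lambda> - Q * ((- a * P * h $ 2 + a * Q * h $ 3) / \<Lambda>)) / (\<Lambda> * \<Lambda>))) *\<^sub>R axis 3 1)) (at v)"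
    unfolding lvec_axis \<Lambda>_def P_def Q_def
    by (auto intro!: derivative_eq_intros D has_derivative_nth simp: pos[THEN less_imp_neq, symmetric] algebra_simps)
  then show ?thesis
    by (rule has_derivative_eq_rhs)
       (simp only: c2 c3, simp add: fun_eq_iff vec_eq_iff forall_3 axis_def y_def inner_vec_def sum_3
          lagr1_def \<Lambda>_def P_def Q_def)
qed

section \<open>Partial derivatives and the Hessian of the tendon energy\<close>

lemma partial_deriv_eq:
  assumes "(f has_derivative D) (at v)"
  shows "partial_deriv i f v = D (axis i 1)"
proof -
  interpret bounded_linear D using assms by (rule has_derivative_bounded_linear)
  have line: "((\<lambda>h::real. v + h *\<^sub>R axis i 1) has_derivative (\<lambda>h. h *\<^sub>R axis i 1)) (at 0)"
    by (auto intro!: derivative_eq_intros)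
  have "((\<lambda>h. f (v + h *\<^sub>R axis i 1)) has_derivative (\<lambda>h. D (h *\<^sub>R axis i 1))) (at 0)"
    using has_derivative_compose[OF line, of f D] assms by simp
  then have "((\<lambda>h. f (v + h *\<^sub>R axis i 1)) has_real_derivative D (axis i 1)) (at 0)"
    by (rule has_derivative_imp_has_field_derivative) (simp add: scaleR)
  then show ?thesis
    unfolding partial_deriv_def by (rule DERIV_imp_deriv)
qed

lemma hessian_lagr1:
  assumes pos: "0 < tendon_length a v" and T: "T \<noteq> 0"
  shows "hessian (lagr1 a T) v
    = (1 / lagr1 a T v) *\<^sub>R outer (d1 \<times> lvec a T v) (d1 \<times> lvec a T v)"
proof -
  let ?y = "d1 \<times> lvec a T v"
  have "partial_deriv i (partial_deriv j (lagr1 a T)) v = ?y \<bullet> axis i 1 / lagr1 a T v * ?y $ j" for i j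
  proof (rule partial_deriv_eq[where D = "\<lambda>h. ?y \<bullet> h / lagr1 a T v * ?y $ j"])
    have "((\<lambda>w. lvec a T w $ j) has_derivative (\<lambda>h. ((?y \<bullet> h / lagr1 a T v) *\<^sub>R ?y) $ j)) (at v)"
      by (rule bounded_linear.has_derivative[OF bounded_linear_vec_nth lvec_has_derivative[OF assms]])
    then have 1: "((\<lambda>w. lvec a T w $ j) has_derivative (\<lambda>h. ?y \<bullet> h / lagr1 a T v * ?y $ j)) (at v)"
      by simp
    \<comment> \<open>The second differentiation needs the first partial derivative near
      \<open>v\<close>, not just at \<open>v\<close>; openness of the region of positive tendon
      length provides the neighbourhood.\<close>
    have 2: "lvec a T w $ j = partial_deriv j (lagr1 a T) w" if "w \<in> {v. 0 < tendon_length a v}" for w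
      using that by (simp add: partial_deriv_eq[OF lagr1_has_derivative] inner_axis)
    show "(partial_deriv j (lagr1 a T) has_derivative (\<lambda>h. ?y \<bullet> h / lagr1 a T v * ?y $ j)) (at v)"
      by (rule has_derivative_transform_within_open[OF 1 open_tendon_region[of a] _ 2])
         (use pos in auto)
  qed
  then show ?thesis
    by (simp add: hessian_def outer_def vec_eq_iff inner_axis)
qed

lemma continuous_on_lvec [continuous_intros]:
  assumes "continuous_on S f" "\<And>x. x \<in> S \<Longrightarrow> tendon_length a (f x) \<noteq> 0"
  shows "continuous_on S (\<lambda>x. lvec a T (f x))"
proof -
  have "lvec a T v = (- (a * T * ((1 - a * v $ 2) / tendon_length a v))) *\<^sub>R axis 2 1
      + (a * T * (a * v $ 3 / tendon_length a v)) *\<^sub>R axis 3 1" for v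
    by (simp add: vec_eq_iff forall_3 axis_def)
  then show ?thesis
    using assms by (simp, intro continuous_intros) auto
qed

section \<open>The first variation of the energy\<close>

text \<open>The gradient of \<open>lagr\<close> in \<open>v\<close> wherever the tendon length is
  positive (\<open>gradient_lagr\<close>), in a form whose continuity is visible.\<close>

definition momentum ::
  "real^3^3 \<Rightarrow> real \<Rightarrow> real \<Rightarrow> (real \<Rightarrow> real^3) \<Rightarrow> real^3 \<Rightarrow> real \<Rightarrow> real^3" where
  "momentum K a T uh v s = K *v (v - uh s) + lvec a T v"

lemma lagr_has_derivative:
  assumes "0 < tendon_length a v" and sym: "transpose K = K"
  shows "((\<lambda>v. lagr K a T uh v s) has_derivative (\<lambda>h. momentum K a T uh v s \<bullet> h)) (at v)"
proof -
  have K: "((\<lambda>v. K *v (v - uh s)) has_derivative (\<lambda>h. K *v h)) (at v)"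
    by (rule bounded_linear.has_derivative[OF matrix_vector_mul_bounded_linear])
       (auto intro!: derivative_eq_intros)
  have id: "((\<lambda>v. v - uh s) has_derivative (\<lambda>h. h)) (at v)"
    by (auto intro!: derivative_eq_intros)
  have K_sym: "x \<bullet> (K *v h) = (K *v x) \<bullet> h" for x h
    by (metis dot_lmul_matrix sym transpose_matrix_vector)
  have "((\<lambda>v. 1/2 * ((v - uh s) \<bullet> (K *v (v - uh s))) + lagr1 a T v) has_derivative
      (\<lambda>h. 1/2 * ((v - uh s) \<bullet> (K *v h) + h \<bullet> (K *v (v - uh s))) + lvec a T v \<bullet> h)) (at v)"
    by (intro has_derivative_add has_derivative_mult_right has_derivative_inner id K
          lagr1_has_derivative assms)
  then show ?thesis
    unfolding lagr_def momentum_def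
    by (rule has_derivative_eq_rhs)
       (simp add: fun_eq_iff K_sym[of "v - uh s"] inner_add_left inner_commute[of _ "K *v (v - uh s)"])
qed

lemma gradient_lagr:
  assumes "0 < tendon_length a v" and "transpose K = K"
  shows "gradient (\<lambda>v. lagr K a T uh v s) v = momentum K a T uh v s"
  by (simp add: gradient_def partial_deriv_eq[OF lagr_has_derivative[OF assms]] inner_axis)

lemma continuous_on_lagr:
  assumes "continuous_on S f" "continuous_on S (\<lambda>x. uh (g x))"
  shows "continuous_on S (\<lambda>x. lagr K a T uh (f x) (g x))"
  unfolding lagr_def lagr1_def
  by (intro continuous_intros assms bounded_linear.continuous_on[OF matrix_vector_mul_bounded_linear])

lemma continuous_on_momentum:
  assumes "continuous_on S f" "continuous_on S (\<lambda>x. uh (g x))"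
    and "\<And>x. x \<in> S \<Longrightarrow> tendon_length a (f x) \<noteq> 0"
  shows "continuous_on S (\<lambda>x. momentum K a T uh (f x) (g x))"
  unfolding momentum_def
  by (intro continuous_intros assms bounded_linear.continuous_on[OF matrix_vector_mul_bounded_linear])

text \<open>Fixes the radius and the partial derivatives whose existence \<open>variation_of\<close>
  asserts. It is instantiated with an arbitrary variation to show that the Hamel equations imply
  criticality, and with coordinate rotations for the converse.\<close>

locale rod_variation =
  fixes K :: "real^3^3" and a T L0 :: real and uh :: "real \<Rightarrow> real^3"
    and R :: "real \<Rightarrow> real^3^3" and V :: "real \<Rightarrow> real \<Rightarrow> real^3^3"
    and r :: real and Vs Ve Ves :: "real \<Rightarrow> real \<Rightarrow> real^3^3"
  assumes L0_pos: "0 < L0" and K_sym: "transpose K = K"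
    and uh_cont: "continuous_on {0..L0} uh"
    and rod: "rod_curve a L0 R"
    and r_pos: "0 < r"
    and V_0: "\<And>s. s \<in> {0..L0} \<Longrightarrow> V 0 s = R s"
    and V_left: "\<And>e. e \<in> {-r<..<r} \<Longrightarrow> V e 0 = R 0"
    and V_right: "\<And>e. e \<in> {-r<..<r} \<Longrightarrow> V e L0 = R L0"
    and V_orth: "\<And>e s. e \<in> {-r<..<r} \<Longrightarrow> s \<in> {0..L0} \<Longrightarrow> orthogonal_matrix (V e s)"
    and V_s: "\<And>e s. e \<in> {-r<..<r} \<Longrightarrow> s \<in> {0..L0} \<Longrightarrow>
      (V e has_vector_derivative Vs e s) (at s within {0..L0})"
    and V_e: "\<And>e s. e \<in> {-r<..<r} \<Longrightarrow> s \<in> {0..L0} \<Longrightarrow>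
      ((\<lambda>e. V e s) has_vector_derivative Ve e s) (at e)"
    and V_es: "\<And>e s. e \<in> {-r<..<r} \<Longrightarrow> s \<in> {0..L0} \<Longrightarrow>
      ((\<lambda>e. Vs e s) has_vector_derivative Ves e s) (at e)"
    and Vs_cont: "continuous_on (Sigma {-r<..<r} (\<lambda>_. {0..L0})) (\<lambda>(e, s). Vs e s)"
    and Ve_cont: "continuous_on (Sigma {-r<..<r} (\<lambda>_. {0..L0})) (\<lambda>(e, s). Ve e s)"
    and Ves_cont: "continuous_on (Sigma {-r<..<r} (\<lambda>_. {0..L0})) (\<lambda>(e, s). Ves e s)"
begin

abbreviation "U \<equiv> {-r<..<r}"
abbreviation "I \<equiv> {0..L0}"

lemma zero_in_U [simp]: "0 \<in> U"
  using r_pos by simp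

text \<open>\<open>variation_of\<close> asserts joint continuity of the partial derivatives only. As
  \<open>Vs\<close> is jointly continuous and the partial derivative in \<open>e\<close> exists,
  \<open>V\<close> is jointly differentiable, hence continuous.\<close>

lemma V_cont: "continuous_on (Sigma U (\<lambda>_. I)) (\<lambda>(e, s). V e s)"
proof -
  have D: "((\<lambda>(e, s). V e s) has_derivative
      (\<lambda>(te, ts). te *\<^sub>R Ve e s + blinfun_apply (blinfun_scaleR_left (Vs e s)) ts))
      (at (e, s) within Sigma U (\<lambda>_. I))" if "e \<in> U" "s \<in> I" for e s
  proof (rule has_derivative_partialsI)
    show "((\<lambda>e. V e s) has_derivative (\<lambda>te. te *\<^sub>R Ve e s)) (at e within U)"
      using V_e[OF that] has_derivative_at_withinI unfolding has_vector_derivative_def by blast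
    show "((\<lambda>s. V e s) has_derivative blinfun_apply (blinfun_scaleR_left (Vs e s))) (at s within I)"
      if "e \<in> U" "s \<in> I" for e s
      using V_s[OF that] unfolding has_vector_derivative_eq_has_derivative_blinfun .
    have "continuous_on (Sigma U (\<lambda>_. I)) (\<lambda>(e, s). blinfun_scaleR_left (Vs e s))"
      using Vs_cont unfolding split_beta' by (intro continuous_intros)
    then show "continuous (at (e, s) within Sigma U (\<lambda>_. I)) (\<lambda>(e, s). blinfun_scaleR_left (Vs e s))"
      using that by (simp add: continuous_on_eq_continuous_within)
  qed (use that in auto)
  show ?thesis
    unfolding continuous_on_eq_continuous_within using has_derivative_continuous[OF D] by blast
qed

lemma slice_cont:
  assumes "continuous_on (Sigma U (\<lambda>_. I)) (\<lambda>(e, s). F e s)" "e \<in> U"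
  shows "continuous_on I (F e)"
proof -
  have "continuous_on I (\<lambda>s. (e, s))"
    by (intro continuous_intros)
  from continuous_on_compose2[OF assms(1) this] show ?thesis
    using assms(2) by (simp add: image_subset_iff)
qed

lemma Ve_left: "e \<in> U \<Longrightarrow> Ve e 0 = 0"
proof -
  assume e: "e \<in> U"
  have "((\<lambda>e. V e 0) has_vector_derivative 0) (at e)"
    by (rule has_vector_derivative_transform_within_open[where f = "\<lambda>_. R 0" and S = U])
       (use V_left e in \<open>auto intro: derivative_intros\<close>)
  then show ?thesis
    using V_e[OF e, of 0] L0_pos vector_derivative_unique_at by auto
qed

lemma Ve_right: "e \<in> U \<Longrightarrow> Ve e L0 = 0"
proof -
  assume e: "e \<in> U"
  have "((\<lambda>e. V e L0) has_vector_derivative 0) (at e)"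
    by (rule has_vector_derivative_transform_within_open[where f = "\<lambda>_. R L0" and S = U])
       (use V_right e in \<open>auto intro: derivative_intros\<close>)
  then show ?thesis
    using V_e[OF e, of L0] L0_pos vector_derivative_unique_at by auto
qed

text \<open>The definition of a variation does not provide the mixed derivative in the order \<open>e\<close>, \<open>s\<close>;
  it is recovered by differentiating \<open>V e s = R 0 + \<integral> Vs e\<close> under the integral.\<close>

lemma Ve_eq_integral:
  assumes e: "e \<in> U" and s: "s \<in> I"
  shows "Ve e s = integral {0..s} (Ves e)"
proof -
  have sub: "{0..s} \<subseteq> I" using s by auto
  have V_int: "R 0 + integral {0..s} (Vs e) = V e s" if "e \<in> U" for e
  proof -
    have "(Vs e has_integral (V e s - V e 0)) {0..s}"
      using s by (intro fundamental_theorem_of_calculus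
          has_vector_derivative_within_subset[OF V_s[OF that] sub]) auto
    then show ?thesis
      using V_left[OF that] by (simp add: integral_unique)
  qed
  have "((\<lambda>e. integral (cbox 0 s) (Vs e)) has_vector_derivative integral (cbox 0 s) (Ves e))
      (at e within U)"
  proof (rule leibniz_rule_vector_derivative)
    show "((\<lambda>e. Vs e t) has_vector_derivative Ves e t) (at e within U)"
      if "e \<in> U" "t \<in> cbox 0 s" for e t
      using V_es[of e t] that sub by (auto intro: has_vector_derivative_at_within)
    show "Vs e integrable_on cbox 0 s" if "e \<in> U" for e
      using continuous_on_subset[OF slice_cont[OF Vs_cont that] sub]
      by (simp add: integrable_continuous_real)
    show "continuous_on (Sigma U (\<lambda>_. cbox 0 s)) (\<lambda>(e, t). Ves e t)"
      by (rule continuous_on_subset[OF Ves_cont]) (use sub in auto)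
  qed (use e in auto)
  then have "((\<lambda>e. R 0 + integral {0..s} (Vs e)) has_vector_derivative integral {0..s} (Ves e)) (at e)"
    using e by (auto intro!: derivative_eq_intros simp: at_within_open[OF _ open_greaterThanLessThan])
  then have "((\<lambda>e. V e s) has_vector_derivative integral {0..s} (Ves e)) (at e)"
    by (rule has_vector_derivative_transform_within_open[where S = U]) (use V_int e in auto)
  then show ?thesis
    using V_e[OF e s] vector_derivative_unique_at by blast
qed

lemma Ve_s:
  assumes e: "e \<in> U" and s: "s \<in> I"
  shows "(Ve e has_vector_derivative Ves e s) (at s within I)"
proof (rule has_vector_derivative_transform[OF s])
  show "((\<lambda>s. integral {0..s} (Ves e)) has_vector_derivative Ves e s) (at s within I)"
    by (rule integral_has_vector_derivative[OF slice_cont[OF Ves_cont e] s])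
qed (use Ve_eq_integral[OF e] in auto)


text \<open>\<open>W e\<close> is the strain of \<open>V e\<close> and \<open>We\<close> its
  derivative in \<open>e\<close>; \<open>\<eta>\<close> is the infinitesimal rotation at
  \<open>e = 0\<close> and \<open>\<eta>'\<close> its derivative in \<open>s\<close>. The mixed
  derivative \<open>Ves\<close> occurs in both \<open>We\<close> and \<open>\<eta>'\<close>, so it
  cancels when they are compared.\<close>

abbreviation "W e s \<equiv> vex (transpose (V e s) ** Vs e s)"
abbreviation "We e s \<equiv> vex (transpose (V e s) ** Ves e s + transpose (Ve e s) ** Vs e s)"
abbreviation "\<eta> s \<equiv> vex (transpose (V 0 s) ** Ve 0 s)"
abbreviation "\<eta>' s \<equiv> vex (transpose (V 0 s) ** Ves 0 s + transpose (Vs 0 s) ** Ve 0 s)"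

lemma strain_V: "e \<in> U \<Longrightarrow> s \<in> I \<Longrightarrow> strain L0 (V e) s = W e s"
  using strain_eq_vex[OF L0_pos _ V_orth V_s] by blast

lemma strain_R:
  assumes s: "s \<in> I"
  shows "strain L0 R s = W 0 s"
proof -
  have "(R has_vector_derivative Vs 0 s) (at s within I)"
    by (rule has_vector_derivative_transform[OF s _ V_s[OF zero_in_U s]]) (simp add: V_0)
  moreover have "orthogonal_matrix (R s)" if "s \<in> I" for s
    using V_orth[OF zero_in_U that] V_0[OF that] by simp
  ultimately show ?thesis
    using strain_eq_vex[OF L0_pos s] V_0[OF s] by simp
qed

lemma W_e: "e \<in> U \<Longrightarrow> s \<in> I \<Longrightarrow> ((\<lambda>e. W e s) has_vector_derivative We e s) (at e)"
  by (intro derivative_intros V_e V_es)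

lemma W_cont: "continuous_on (Sigma U (\<lambda>_. I)) (\<lambda>(e, s). W e s)"
  using V_cont Vs_cont unfolding split_beta' by (intro continuous_intros)

lemma We_cont: "continuous_on (Sigma U (\<lambda>_. I)) (\<lambda>(e, s). We e s)"
  using V_cont Vs_cont Ve_cont Ves_cont unfolding split_beta' by (intro continuous_intros)

lemma \<eta>_s: "s \<in> I \<Longrightarrow> (\<eta> has_vector_derivative \<eta>' s) (at s within I)"
  by (intro derivative_intros V_s Ve_s zero_in_U)

lemma \<eta>_ends: "\<eta> 0 = 0" "\<eta> L0 = 0"
  by (simp_all add: Ve_left[OF zero_in_U] Ve_right[OF zero_in_U] vex_def vec_eq_iff forall_3 matrix_matrix_mult_def)

text \<open>With \<open>Vs = V ** hat W\<close> and \<open>Ve = V ** hat \<eta>\<close> at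
  \<open>e = 0\<close>, the difference of \<open>We\<close> and \<open>\<eta>'\<close> comes from
  \<open>transpose Ve ** Vs - transpose Vs ** Ve\<close>, which is the commutator of
  \<open>hat W\<close> and \<open>hat \<eta>\<close>.\<close>

lemma We_0:
  assumes s: "s \<in> I"
  shows "We 0 s = \<eta>' s + W 0 s \<times> \<eta> s"
proof -
  have skew_products: "transpose (A ** hat x) ** (A ** hat y) = - (hat x ** hat y)"
    if "orthogonal_matrix A" for A x y
  proof -
    have "transpose (A ** hat x) ** (A ** hat y) = transpose (hat x) ** (transpose A ** A) ** hat y"
      by (simp add: matrix_transpose_mul matrix_mul_assoc)
    then show ?thesis
      using that by (simp add: orthogonal_matrix transpose_hat matrix_3_simps)
  qed
  have Vs: "Vs 0 s = V 0 s ** hat (W 0 s)"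
    using orthogonal_curve_derivative[OF V_orth[OF zero_in_U] s at_within_Icc_neq_bot[OF L0_pos s]
        V_s[OF zero_in_U s]] .
  have Ve: "Ve 0 s = V 0 s ** hat (\<eta> s)"
    using orthogonal_curve_derivative[of U "\<lambda>e. V e s", OF V_orth[OF _ s] zero_in_U]
      has_vector_derivative_at_within[OF V_e[OF zero_in_U s]] at_within_open[OF zero_in_U]
    by simp
  note orth = V_orth[OF zero_in_U s]
  have "transpose (Ve 0 s) ** Vs 0 s = transpose (Vs 0 s) ** Ve 0 s + hat (W 0 s \<times> \<eta> s)"
    using skew_products[OF orth, of "\<eta> s" "W 0 s"] skew_products[OF orth, of "W 0 s" "\<eta> s"]
    by (simp flip: Vs Ve add: hat_cross)
  then show ?thesis
    using bounded_linear.linear[OF bounded_linear_vex] by (simp add: linear_add)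
qed

text \<open>Differentiation under the integral. Differentiating \<open>lagr\<close> uses a positive
  tendon length, which is given for \<open>e = 0\<close> alone; compactness of \<open>I\<close>
  extends it to all small \<open>e\<close>, uniformly in \<open>s\<close>.\<close>

lemma energy_derivative:
  "((\<lambda>e. rod_energy K a T uh L0 (V e)) has_real_derivative
    integral I (\<lambda>s. momentum K a T uh (strain L0 R s) s \<bullet> (\<eta>' s + strain L0 R s \<times> \<eta> s))) (at 0)"
proof -
  let ?\<Lambda> = "\<lambda>(e, s). tendon_length a (W e s)"
  have \<Lambda>_cont: "continuous_on (Sigma U (\<lambda>_. I)) ?\<Lambda>"
    using W_cont unfolding split_beta' by (rule continuous_on_tendon_length)
  have "\<exists>s0\<in>I. \<forall>s\<in>I. ?\<Lambda> (0, s0) \<le> ?\<Lambda> (0, s)"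
    using L0_pos slice_cont[OF \<Lambda>_cont zero_in_U] by (intro continuous_attains_inf) auto
  then obtain s0 where s0: "s0 \<in> I" "\<And>s. s \<in> I \<Longrightarrow> ?\<Lambda> (0, s0) \<le> ?\<Lambda> (0, s)"
    by blast
  have \<delta>: "0 < ?\<Lambda> (0, s0) / 2"
    using rod s0(1) unfolding rod_curve_def by (simp flip: strain_R[OF s0(1)])
  \<comment> \<open>By compactness, continuity in \<open>e\<close> is uniform in \<open>s\<close>. A
    deviation of at most half the minimum over \<open>I\<close> leaves the tendon length
    positive.\<close>
  obtain X where X: "0 \<in> X" "open X"
    "\<forall>e\<in>X \<inter> U. \<forall>s\<in>I. dist (?\<Lambda> (e, s)) (?\<Lambda> (0, s)) \<le> ?\<Lambda> (0, s0) / 2"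
    using continuous_on_prod_compactE[OF \<Lambda>_cont _ zero_in_U \<delta>] by auto
  have "open (X \<inter> U)" "0 \<in> X \<inter> U"
    using X r_pos by auto
  \<comment> \<open>The Leibniz rule is applied on a convex set, hence the ball.\<close>
  then obtain d where d: "d > 0" "ball 0 d \<subseteq> X \<inter> U"
    by (meson openE)
  define B where "B = ball (0::real) d"
  have B: "open B" "convex B" "0 \<in> B" and BU: "\<And>e. e \<in> B \<Longrightarrow> e \<in> U"
    using d by (auto simp: B_def)
  have pos: "0 < tendon_length a (W e s)" if "e \<in> B" "s \<in> I" for e s
  proof -
    have "dist (?\<Lambda> (e, s)) (?\<Lambda> (0, s)) \<le> ?\<Lambda> (0, s0) / 2"
      using X(3) that d(2) unfolding B_def by blast
    then show ?thesis
      using s0(2)[OF that(2)] \<delta> unfolding dist_real_def prod.case by linarith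
  qed
  have BI: "Sigma B (\<lambda>_. I) \<subseteq> Sigma U (\<lambda>_. I)"
    using BU by blast
  have uh_cont2: "continuous_on (Sigma B (\<lambda>_. I)) (\<lambda>x. uh (snd x))"
    by (rule continuous_on_compose2[OF uh_cont]) (auto intro: continuous_intros)
  have W_contB: "continuous_on (Sigma B (\<lambda>_. I)) (\<lambda>x. W (fst x) (snd x))"
    using continuous_on_subset[OF W_cont BI] unfolding split_beta' .
  have We_contB: "continuous_on (Sigma B (\<lambda>_. I)) (\<lambda>x. We (fst x) (snd x))"
    using continuous_on_subset[OF We_cont BI] unfolding split_beta' .
  have "((\<lambda>e. integral (cbox 0 L0) (\<lambda>s. lagr K a T uh (W e s) s)) has_field_derivative
      integral (cbox 0 L0) (\<lambda>s. momentum K a T uh (W 0 s) s \<bullet> We 0 s)) (at 0 within B)"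
  proof (rule leibniz_rule_field_derivative)
    show "((\<lambda>e. lagr K a T uh (W e s) s) has_field_derivative
        momentum K a T uh (W e s) s \<bullet> We e s) (at e within B)"
      if "e \<in> B" "s \<in> cbox 0 L0" for e s
    proof -
      have "s \<in> I" using that by simp
      have "((\<lambda>e. W e s) has_derivative (\<lambda>h. h *\<^sub>R We e s)) (at e)"
        using W_e[OF BU[OF that(1)] \<open>s \<in> I\<close>] by (simp add: has_vector_derivative_def)
      from has_derivative_compose[OF this lagr_has_derivative[OF pos[OF that(1) \<open>s \<in> I\<close>] K_sym]]
      have "((\<lambda>e. lagr K a T uh (W e s) s) has_derivative
          (\<lambda>h. momentum K a T uh (W e s) s \<bullet> (h *\<^sub>R We e s))) (at e)" .
      then have "((\<lambda>e. lagr K a T uh (W e s) s) has_field_derivative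
          momentum K a T uh (W e s) s \<bullet> We e s) (at e)"
        by (rule has_derivative_imp_has_field_derivative) simp
      then show ?thesis
        by (rule has_field_derivative_at_within)
    qed
    have lagr_cont: "continuous_on (Sigma B (\<lambda>_. I)) (\<lambda>x. lagr K a T uh (W (fst x) (snd x)) (snd x))"
      by (rule continuous_on_lagr[OF W_contB uh_cont2])
    show "(\<lambda>s. lagr K a T uh (W e s) s) integrable_on cbox 0 L0" if "e \<in> B" for e
    proof -
      have "continuous_on I (\<lambda>s. (e, s))"
        by (intro continuous_intros)
      from continuous_on_compose2[OF lagr_cont this] show ?thesis
        using that by (simp add: image_subset_iff integrable_continuous_real)
    qed
    show "continuous_on (Sigma B (\<lambda>_. cbox 0 L0)) (\<lambda>(e, s). momentum K a T uh (W e s) s \<bullet> We e s)"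
      unfolding split_beta' box_real
      by (intro continuous_on_inner continuous_on_momentum W_contB uh_cont2 We_contB)
         (use pos in force)
  qed (use B in auto)
  then have "((\<lambda>e. integral I (\<lambda>s. lagr K a T uh (W e s) s)) has_field_derivative
      integral I (\<lambda>s. momentum K a T uh (W 0 s) s \<bullet> We 0 s)) (at 0)"
    using B at_within_open[of 0 B] by simp
  moreover have "integral I (\<lambda>s. momentum K a T uh (W 0 s) s \<bullet> We 0 s) =
      integral I (\<lambda>s. momentum K a T uh (strain L0 R s) s \<bullet> (\<eta>' s + strain L0 R s \<times> \<eta> s))"
    by (rule integral_cong) (simp add: We_0 strain_R)
  moreover have "integral I (\<lambda>s. lagr K a T uh (W e s) s) = rod_energy K a T uh L0 (V e)"
    if "e \<in> B" for e
    unfolding rod_energy_def by (rule integral_cong) (simp add: strain_V[OF BU[OF that]])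
  ultimately show ?thesis
    using B by (simp add: has_field_derivative_transform_within_open[OF _ B(1,3)])
qed

end

section \<open>Rotation variations about a fixed axis\<close>

text \<open>With \<open>G\<close> a primitive of \<open>g\<close> and \<open>c\<close> the mean of \<open>f - G\<close>, testing against the primitive
  of \<open>f - G - c\<close> gives \<open>\<integral> (f - G - c)\<^sup>2 = 0\<close>.\<close>

lemma du_Bois_Reymond:
  fixes f g :: "real \<Rightarrow> real"
  assumes ab: "a < b" and f: "continuous_on {a..b} f" and g: "continuous_on {a..b} g"
    and weak: "\<And>\<phi> \<phi>'. (\<And>s. s \<in> {a..b} \<Longrightarrow> (\<phi> has_vector_derivative \<phi>' s) (at s within {a..b})) \<Longrightarrow>
      continuous_on {a..b} \<phi>' \<Longrightarrow> \<phi> a = 0 \<Longrightarrow> \<phi> b = 0 \<Longrightarrow>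
      integral {a..b} (\<lambda>s. f s * \<phi>' s + g s * \<phi> s) = 0"
    and s: "s \<in> {a..b}"
  shows "(f has_vector_derivative g s) (at s within {a..b})"
proof -
  define G where "G s = integral {a..s} g" for s
  have G: "(G has_vector_derivative g s) (at s within {a..b})" if "s \<in> {a..b}" for s
    unfolding G_def by (rule integral_has_vector_derivative[OF g that])
  then have G_cont: "continuous_on {a..b} G"
    by (rule continuous_on_vector_derivative)
  define c where "c = integral {a..b} (\<lambda>t. f t - G t) / (b - a)"
  define \<phi>' where "\<phi>' t = f t - G t - c" for t
  define \<phi> where "\<phi> s = integral {a..s} \<phi>'" for s
  have \<phi>'_cont: "continuous_on {a..b} \<phi>'"
    unfolding \<phi>'_def by (intro continuous_intros f G_cont)
  have \<phi>: "(\<phi> has_vector_derivative \<phi>' s) (at s within {a..b})" if "s \<in> {a..b}" for s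
    unfolding \<phi>_def by (rule integral_has_vector_derivative[OF \<phi>'_cont that])
  then have \<phi>_cont: "continuous_on {a..b} \<phi>"
    by (rule continuous_on_vector_derivative)
  have \<phi>_a: "\<phi> a = 0"
    by (simp add: \<phi>_def)
  have "integral {a..b} \<phi>' = integral {a..b} (\<lambda>t. f t - G t) - integral {a..b} (\<lambda>t. c)"
    unfolding \<phi>'_def
    by (intro integral_diff integrable_continuous_real continuous_intros f G_cont)
  also have "\<dots> = 0"
    using ab by (simp add: c_def)
  finally have \<phi>_b: "\<phi> b = 0"
    by (simp add: \<phi>_def)
  have 1: "((\<lambda>s. f s * \<phi>' s + g s * \<phi> s) has_integral 0) {a..b}"
    using weak[OF \<phi> \<phi>'_cont \<phi>_a \<phi>_b]
    by (auto intro!: integrable_continuous_real continuous_intros f g \<phi>_cont \<phi>'_cont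
          simp: has_integral_iff)
  have 2: "((\<lambda>s. G s * \<phi>' s + g s * \<phi> s) has_integral (G b * \<phi> b - G a * \<phi> a)) {a..b}"
    using ab
    by (intro fundamental_theorem_of_calculus
          bounded_bilinear.has_vector_derivative[OF bounded_bilinear_mult] G \<phi>) auto
  have 3: "((\<lambda>s. c * \<phi>' s) has_integral (c * \<phi> b - c * \<phi> a)) {a..b}"
    using ab
    by (intro fundamental_theorem_of_calculus has_vector_derivative_mult_right \<phi>) auto
  have "integral {a..b} (\<lambda>s. (f s * \<phi>' s + g s * \<phi> s) - ((G s * \<phi>' s + g s * \<phi> s) + c * \<phi>' s)) = 0"
    using has_integral_diff[OF 1 has_integral_add[OF 2 3]] by (simp add: \<phi>_a \<phi>_b integral_unique)
  also have "(\<lambda>s. (f s * \<phi>' s + g s * \<phi> s) - ((G s * \<phi>' s + g s * \<phi> s) + c * \<phi>' s)) = (\<lambda>s. \<phi>' s * \<phi>' s)"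
    by (simp add: fun_eq_iff \<phi>'_def algebra_simps)
  finally have "\<forall>s\<in>{a..b}. \<phi>' s * \<phi>' s = 0"
    by (subst (asm) integral_eq_0_iff) (auto intro!: continuous_intros \<phi>'_cont ab)
  then have f_eq: "G s + c = f s" if "s \<in> {a..b}" for s
  proof -
    have "\<phi>' s = 0"
      using \<open>\<forall>s\<in>{a..b}. \<phi>' s * \<phi>' s = 0\<close> that by simp
    then show ?thesis
      by (simp add: \<phi>'_def)
  qed
  have "((\<lambda>s. G s + c) has_vector_derivative g s) (at s within {a..b})"
    using G[OF s] by (auto intro!: derivative_eq_intros)
  then show ?thesis
    by (rule has_vector_derivative_transform[OF s, rotated]) (simp add: f_eq)
qed

text \<open>Rodrigues' formula for the rotation by \<open>\<theta>\<close> about the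
  \<open>i\<close>-th coordinate axis. \<open>rot'\<close> and \<open>rot''\<close> are its first
  two derivatives in \<open>\<theta>\<close>; the second enters through the mixed derivative of the
  test variation.\<close>

definition rot :: "3 \<Rightarrow> real \<Rightarrow> real^3^3" where
  "rot i \<theta> = mat 1 + sin \<theta> *\<^sub>R hat (axis i 1) + (1 - cos \<theta>) *\<^sub>R (hat (axis i 1) ** hat (axis i 1))"

definition rot' :: "3 \<Rightarrow> real \<Rightarrow> real^3^3" where
  "rot' i \<theta> = cos \<theta> *\<^sub>R hat (axis i 1) + sin \<theta> *\<^sub>R (hat (axis i 1) ** hat (axis i 1))"

definition rot'' :: "3 \<Rightarrow> real \<Rightarrow> real^3^3" where
  "rot'' i \<theta> = - sin \<theta> *\<^sub>R hat (axis i 1) + cos \<theta> *\<^sub>R (hat (axis i 1) ** hat (axis i 1))"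

lemma rotation_matrix_rot: "rotation_matrix (rot i \<theta>)"
proof -
  have sc: "sin \<theta> * sin \<theta> = 1 - cos \<theta> * cos \<theta>"
    using sin_squared_eq[of \<theta>] by (simp add: power2_eq_square)
  consider "i = 1" | "i = 2" | "i = 3"
    using exhaust_3 by blast
  then show ?thesis
    by cases (simp_all add: rotation_matrix_def orthogonal_matrix det_3 rot_def matrix_3_simps
        axis_def algebra_simps sc)
qed

lemma rot_0: "rot i 0 = mat 1" and rot'_0: "rot' i 0 = hat (axis i 1)"
  by (simp_all add: rot_def rot'_def)

lemma rot_has_vector_derivative:
  assumes "(f has_vector_derivative f') (at x within S)"
  shows "((\<lambda>x. rot i (f x)) has_vector_derivative f' *\<^sub>R rot' i (f x)) (at x within S)"
    and "((\<lambda>x. rot' i (f x)) has_vector_derivative f' *\<^sub>R rot'' i (f x)) (at x within S)"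
proof -
  have "(rot i has_vector_derivative rot' i \<theta>) F" "(rot' i has_vector_derivative rot'' i \<theta>) F"
    if "F = at \<theta> within f ` S" for \<theta> F
    unfolding rot_def[abs_def] rot'_def[abs_def] rot''_def that
    by (auto intro!: derivative_eq_intros)
  from vector_diff_chain_within[OF assms this(1)[OF refl]]
    vector_diff_chain_within[OF assms this(2)[OF refl]]
  show "((\<lambda>x. rot i (f x)) has_vector_derivative f' *\<^sub>R rot' i (f x)) (at x within S)"
    and "((\<lambda>x. rot' i (f x)) has_vector_derivative f' *\<^sub>R rot'' i (f x)) (at x within S)"
    by (simp_all add: o_def)
qed

lemma continuous_on_rot [continuous_intros]:
  fixes f :: "'a::t2_space \<Rightarrow> real"
  assumes "continuous_on S f"
  shows "continuous_on S (\<lambda>x. rot i (f x))" "continuous_on S (\<lambda>x. rot' i (f x))"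
    "continuous_on S (\<lambda>x. rot'' i (f x))"
  unfolding rot_def rot'_def rot''_def
  by - (intro continuous_intros assms; fail)+

lemma rotation_matrix_mult:
  fixes A B :: "real^'n^'n"
  shows "rotation_matrix A \<Longrightarrow> rotation_matrix B \<Longrightarrow> rotation_matrix (A ** B)"
  by (simp add: rotation_matrix_def orthogonal_matrix_mul det_mul)


text \<open>Moves \<open>u \<times>\<close> from the infinitesimal rotation onto \<open>p\<close>,
  where it yields the right-hand side of the Hamel equations.\<close>

lemma cross_inner_assoc: "(p \<times> u) \<bullet> x = p \<bullet> (u \<times> x)"
  by (simp add: inner_vec_def sum_3 cross_components algebra_simps)

text \<open>These variations have \<open>\<eta> = \<phi> *\<^sub>R axis i 1\<close>, so the first
  variation reduces to the scalar weak form that \<open>du_Bois_Reymond\<close> tests, one component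
  of \<open>p\<close> at a time.\<close>

lemma axis_variation:
  fixes R :: "real \<Rightarrow> real^3^3" and \<phi> \<phi>' :: "real \<Rightarrow> real" and i :: 3 and T :: real
  assumes L0: "0 < L0" and K: "transpose K = K" and uh: "continuous_on {0..L0} uh"
    and rod: "rod_curve a L0 R"
    and \<phi>: "\<And>s. s \<in> {0..L0} \<Longrightarrow> (\<phi> has_vector_derivative \<phi>' s) (at s within {0..L0})"
    and \<phi>': "continuous_on {0..L0} \<phi>'" and ends: "\<phi> 0 = 0" "\<phi> L0 = 0"
  defines "V \<equiv> \<lambda>e s. R s ** rot i (e * \<phi> s)"
    and "p \<equiv> \<lambda>s. momentum K a T uh (strain L0 R s) s"
  shows "variation_of L0 R V"
    and "((\<lambda>e. rod_energy K a T uh L0 (V e)) has_real_derivative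
      integral {0..L0} (\<lambda>s. p s $ i * \<phi>' s + (p s \<times> strain L0 R s) $ i * \<phi> s)) (at 0)"
proof -
  \<comment> \<open>The family is defined for every \<open>e\<close>; the radius 1 is an arbitrary
    choice.\<close>
  let ?I = "{0..L0}" and ?U = "{-1<..<1::real}"
  obtain R' where R': "\<And>s. s \<in> ?I \<Longrightarrow> (R has_vector_derivative R' s) (at s within ?I)"
    and R'_cont: "continuous_on ?I R'"
    using rod unfolding rod_curve_def One_nat_def Ck_on.simps by blast
  have R_rot: "rotation_matrix (R s)" if "s \<in> ?I" for s
    using rod that unfolding rod_curve_def by blast
  have \<phi>_cont: "continuous_on ?I \<phi>" and R_cont: "continuous_on ?I R"
    using continuous_on_vector_derivative \<phi> R' by blast+
  define Vs where "Vs e s = R s ** ((e * \<phi>' s) *\<^sub>R rot' i (e * \<phi> s)) + R' s ** rot i (e * \<phi> s)" for e s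
  define Ve where "Ve e s = R s ** (\<phi> s *\<^sub>R rot' i (e * \<phi> s))" for e s
  define Ves where "Ves e s = R s ** ((e * \<phi>' s) *\<^sub>R (\<phi> s *\<^sub>R rot'' i (e * \<phi> s))
      + \<phi>' s *\<^sub>R rot' i (e * \<phi> s)) + R' s ** (\<phi> s *\<^sub>R rot' i (e * \<phi> s))" for e s
  have V_at_0: "V 0 s = R s" for s
    by (simp add: V_def rot_0)
  have V_ends: "V e 0 = R 0" "V e L0 = R L0" for e
    by (simp_all add: V_def rot_0 ends)
  have V_rot: "rotation_matrix (V e s)" if "s \<in> ?I" for e s
    unfolding V_def by (intro rotation_matrix_mult R_rot rotation_matrix_rot that)
  have V_s: "(V e has_vector_derivative Vs e s) (at s within ?I)" if "s \<in> ?I" for e s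
    unfolding V_def Vs_def
    by (intro has_vector_derivative_matrix_mult rot_has_vector_derivative
        has_vector_derivative_mult_right R' \<phi> that)
  have scale: "((\<lambda>e. e * c) has_vector_derivative c) (at e)" for c e :: real
    by (auto intro!: derivative_eq_intros)
  have V_e: "((\<lambda>e. V e s) has_vector_derivative Ve e s) (at e)" for e s
    using has_vector_derivative_matrix_mult[OF has_vector_derivative_const
        rot_has_vector_derivative(1)[OF scale]]
    by (simp add: V_def Ve_def)
  have V_es: "((\<lambda>e. Vs e s) has_vector_derivative Ves e s) (at e)" for e s
  proof -
    have "((\<lambda>e. (e * \<phi>' s) *\<^sub>R rot' i (e * \<phi> s)) has_vector_derivative
        (e * \<phi>' s) *\<^sub>R (\<phi> s *\<^sub>R rot'' i (e * \<phi> s)) + \<phi>' s *\<^sub>R rot' i (e * \<phi> s)) (at e)"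
      by (intro bounded_bilinear.has_vector_derivative[OF bounded_bilinear_scaleR]
          rot_has_vector_derivative scale)
    from has_vector_derivative_add[OF
        has_vector_derivative_matrix_mult[OF has_vector_derivative_const this]
        has_vector_derivative_matrix_mult[OF has_vector_derivative_const
          rot_has_vector_derivative(1)[OF scale]]]
    show ?thesis
      unfolding Vs_def Ves_def by simp
  qed
  have cont: "continuous_on (Sigma ?U (\<lambda>_. ?I)) (\<lambda>x. f (snd x))" if "continuous_on ?I f"
    for f :: "real \<Rightarrow> 'b::topological_space"
    by (rule continuous_on_compose2[OF that]) (auto intro: continuous_intros)
  note joint = cont[OF \<phi>_cont] cont[OF \<phi>'] cont[OF R_cont] cont[OF R'_cont]
  have Vs_cont: "continuous_on (Sigma ?U (\<lambda>_. ?I)) (\<lambda>(e, s). Vs e s)"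
    and Ve_cont: "continuous_on (Sigma ?U (\<lambda>_. ?I)) (\<lambda>(e, s). Ve e s)"
    and Ves_cont: "continuous_on (Sigma ?U (\<lambda>_. ?I)) (\<lambda>(e, s). Ves e s)"
    unfolding split_beta' Vs_def Ve_def Ves_def by - (intro continuous_intros joint; fail)+
  show "variation_of L0 R V"
    unfolding variation_of_def
    by (intro conjI exI[of _ "1::real"] exI[of _ Vs] exI[of _ Ve] exI[of _ Ves])
       (use V_at_0 V_ends V_rot V_s V_e V_es Vs_cont Ve_cont Ves_cont in auto)
  interpret rod_variation K a T L0 uh R V 1 Vs Ve Ves
    by unfold_locales
       (use L0 K uh rod V_at_0 V_ends V_rot V_s V_e V_es Vs_cont Ve_cont Ves_cont in
         \<open>auto simp: rotation_matrix_def\<close>)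
  have \<eta>_eq: "\<eta> s = \<phi> s *\<^sub>R axis i 1" if "s \<in> ?I" for s
  proof -
    have "transpose (V 0 s) ** Ve 0 s = (transpose (R s) ** R s) ** (\<phi> s *\<^sub>R hat (axis i 1))"
      by (simp add: V_at_0 Ve_def rot'_0 matrix_mul_assoc)
    also have "\<dots> = hat (\<phi> s *\<^sub>R axis i 1)"
      using R_rot[OF that] bounded_linear.linear[OF bounded_linear_hat]
      by (simp add: rotation_matrix_def orthogonal_matrix linear_cmul)
    finally show ?thesis
      by simp
  qed
  \<comment> \<open>Uniqueness of the derivative of \<open>\<eta>\<close> identifies
    \<open>\<eta>'\<close> without expanding its matrix expression.\<close>
  have \<eta>'_eq: "\<eta>' s = \<phi>' s *\<^sub>R axis i 1" if "s \<in> ?I" for s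
  proof -
    have "((\<lambda>s. \<phi> s *\<^sub>R axis i 1) has_vector_derivative \<eta>' s) (at s within ?I)"
      by (rule has_vector_derivative_transform[OF that \<eta>_eq[symmetric] \<eta>_s[OF that]])
    moreover have "((\<lambda>s. \<phi> s *\<^sub>R axis i 1) has_vector_derivative \<phi>' s *\<^sub>R axis i 1) (at s within ?I)"
      by (rule bounded_linear.has_vector_derivative[OF bounded_linear_scaleR_left \<phi>[OF that]])
    ultimately show ?thesis
      using vector_derivative_unique_within[OF at_within_Icc_neq_bot[OF L0 that]] by blast
  qed
  have "integral ?I (\<lambda>s. p s \<bullet> (\<eta>' s + strain L0 R s \<times> \<eta> s)) =
      integral ?I (\<lambda>s. p s $ i * \<phi>' s + (p s \<times> strain L0 R s) $ i * \<phi> s)"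
    by (rule integral_cong)
       (simp add: \<eta>_eq \<eta>'_eq inner_add_right flip: cross_inner_assoc, simp add: inner_axis)
  then show "((\<lambda>e. rod_energy K a T uh L0 (V e)) has_real_derivative
      integral ?I (\<lambda>s. p s $ i * \<phi>' s + (p s \<times> strain L0 R s) $ i * \<phi> s)) (at 0)"
    using energy_derivative by (simp add: p_def)
qed

section \<open>Critical curves and the Hamel equations\<close>

lemma strain_of_rod_curve:
  assumes L0: "0 < L0" and rod: "rod_curve a L0 R"
  shows "s \<in> {0..L0} \<Longrightarrow> (R has_vector_derivative R s ** hat (strain L0 R s)) (at s within {0..L0})"
    and "continuous_on {0..L0} (strain L0 R)"
proof -
  obtain R' where R': "\<And>s. s \<in> {0..L0} \<Longrightarrow> (R has_vector_derivative R' s) (at s within {0..L0})"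
    and R'_cont: "continuous_on {0..L0} R'"
    using rod unfolding rod_curve_def One_nat_def Ck_on.simps by blast
  have orth: "orthogonal_matrix (R s)" if "s \<in> {0..L0}" for s
    using rod that by (simp add: rod_curve_def rotation_matrix_def)
  have strain: "strain L0 R s = vex (transpose (R s) ** R' s)" if "s \<in> {0..L0}" for s
    using strain_eq_vex[OF L0 that orth R'[OF that]] .
  show "(R has_vector_derivative R s ** hat (strain L0 R s)) (at s within {0..L0})"
    if "s \<in> {0..L0}"
    using R'[OF that] strain[OF that]
      orthogonal_curve_derivative[OF orth that at_within_Icc_neq_bot[OF L0 that] R'[OF that]]
    by simp
  have "continuous_on {0..L0} R"
    using continuous_on_vector_derivative R' by blast
  then have "continuous_on {0..L0} (\<lambda>s. vex (transpose (R s) ** R' s))"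
    by (intro continuous_intros R'_cont)
  then show "continuous_on {0..L0} (strain L0 R)"
    by (rule continuous_on_eq) (simp add: strain)
qed

text \<open>The gradient equals \<open>momentum\<close> at every point of \<open>{0..L0}\<close>
  because the tendon length is positive there; this suffices since the derivatives are taken within
  that interval.\<close>

lemma hamel_equations_iff:
  fixes uh :: "real \<Rightarrow> real^3" and T :: real
  assumes K: "transpose K = K" and rod: "rod_curve a L0 R"
  defines "p \<equiv> \<lambda>s. momentum K a T uh (strain L0 R s) s"
  shows "hamel_equations K a T uh L0 R \<longleftrightarrow>
    (\<forall>s\<in>{0..L0}. (p has_vector_derivative p s \<times> strain L0 R s) (at s within {0..L0}))"
proof -
  define g where "g = (\<lambda>s. gradient (\<lambda>v. lagr K a T uh v s) (strain L0 R s))"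
  have g: "g s = p s" if "s \<in> {0..L0}" for s
    using gradient_lagr[OF _ K] rod that unfolding g_def p_def rod_curve_def by blast
  have "(g has_vector_derivative w) (at s within {0..L0}) \<longleftrightarrow>
      (p has_vector_derivative w) (at s within {0..L0})" if "s \<in> {0..L0}" for s w
    using that g by (metis has_vector_derivative_transform)
  moreover have "hamel_equations K a T uh L0 R \<longleftrightarrow>
      (\<forall>s\<in>{0..L0}. (g has_vector_derivative g s \<times> strain L0 R s) (at s within {0..L0}))"
    unfolding hamel_equations_def Let_def g_def ..
  ultimately show ?thesis
    using g by simp
qed

lemma has_vector_derivative_vec_componentwise:
  fixes f :: "real \<Rightarrow> real^'n"
  assumes "\<And>i. ((\<lambda>s. f s $ i) has_vector_derivative f' $ i) (at s within S)"
  shows "(f has_vector_derivative f') (at s within S)"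
  using assms unfolding has_vector_derivative_def
  by (subst has_derivative_componentwise_within) (auto simp: Basis_vec_def inner_axis)

lemma critical_iff_hamel:
  fixes K :: "real^3^3"
  assumes L0: "0 < L0" and K: "transpose K = K" and uh: "continuous_on {0..L0} uh"
    and rod: "rod_curve a L0 R"
  shows "critical_curve K a T uh L0 R \<longleftrightarrow> hamel_equations K a T uh L0 R"
proof -
  define p where "p = (\<lambda>s. momentum K a T uh (strain L0 R s) s)"
  have hamel: "hamel_equations K a T uh L0 R \<longleftrightarrow>
      (\<forall>s\<in>{0..L0}. (p has_vector_derivative p s \<times> strain L0 R s) (at s within {0..L0}))"
    unfolding p_def by (rule hamel_equations_iff[OF K rod])
  have u_cont: "continuous_on {0..L0} (strain L0 R)"
    by (rule strain_of_rod_curve[OF L0 rod])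
  have p_cont: "continuous_on {0..L0} p"
    unfolding p_def
    by (rule continuous_on_momentum[OF u_cont uh]) (use rod in \<open>force simp: rod_curve_def\<close>)
  show ?thesis
    unfolding hamel
  proof (intro iffI ballI)
    fix s assume crit: "critical_curve K a T uh L0 R" and s: "s \<in> {0..L0}"
    show "(p has_vector_derivative p s \<times> strain L0 R s) (at s within {0..L0})"
    \<comment> \<open>For each \<open>i\<close>, \<open>p s $ i\<close> plays the role of
      \<open>f\<close> and \<open>(p s \<times> strain L0 R s) $ i\<close> that of \<open>g\<close>.
      Both are known to be continuous, and differentiability of the former is the outcome.\<close>
    proof (rule has_vector_derivative_vec_componentwise, rule du_Bois_Reymond[OF L0 _ _ _ s])
      fix i :: 3 and \<phi> \<phi>' :: "real \<Rightarrow> real"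
      assume \<phi>: "\<And>s. s \<in> {0..L0} \<Longrightarrow> (\<phi> has_vector_derivative \<phi>' s) (at s within {0..L0})"
        "continuous_on {0..L0} \<phi>'" "\<phi> 0 = 0" "\<phi> L0 = 0"
      note axis = axis_variation(1)[OF L0 K uh rod \<phi>, where i = i]
        axis_variation(2)[OF L0 K uh rod \<phi>, where i = i and T = T]
      show "integral {0..L0} (\<lambda>s. p s $ i * \<phi>' s + (p s \<times> strain L0 R s) $ i * \<phi> s) = 0"
        using axis(2) crit[unfolded critical_curve_def, rule_format, OF axis(1)] DERIV_unique
        unfolding p_def by blast
    qed (intro continuous_intros continuous_on_cross p_cont u_cont)+
  next
    assume p: "\<forall>s\<in>{0..L0}. (p has_vector_derivative p s \<times> strain L0 R s) (at s within {0..L0})"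
    show "critical_curve K a T uh L0 R"
      unfolding critical_curve_def
    proof (intro allI impI)
      fix V assume "variation_of L0 R V"
      then obtain r Vs Ve Ves where "0 < r"
        and "\<forall>s\<in>{0..L0}. V 0 s = R s"
        and "\<forall>e\<in>{-r<..<r}. V e 0 = R 0 \<and> V e L0 = R L0"
        and "\<forall>e\<in>{-r<..<r}. \<forall>s\<in>{0..L0}.
           rotation_matrix (V e s) \<and>
           (V e has_vector_derivative Vs e s) (at s within {0..L0}) \<and>
           ((\<lambda>e. V e s) has_vector_derivative Ve e s) (at e) \<and>
           ((\<lambda>e. Vs e s) has_vector_derivative Ves e s) (at e)"
        and "\<forall>F\<in>{Vs, Ve, Ves}.
           continuous_on (Sigma {-r<..<r} (\<lambda>_. {0..L0})) (\<lambda>(e, s). F e s)"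
        unfolding variation_of_def by blast
      then interpret rod_variation K a T L0 uh R V r Vs Ve Ves
        using L0 K uh rod by unfold_locales (simp_all add: rotation_matrix_def)
      have "((\<lambda>s. p s \<bullet> (\<eta>' s + strain L0 R s \<times> \<eta> s)) has_integral
          p L0 \<bullet> \<eta> L0 - p 0 \<bullet> \<eta> 0) {0..L0}"
      proof (rule fundamental_theorem_of_calculus)
        fix s assume s: "s \<in> {0..L0}"
        have "((\<lambda>s. p s \<bullet> \<eta> s) has_vector_derivative
            p s \<bullet> \<eta>' s + (p s \<times> strain L0 R s) \<bullet> \<eta> s) (at s within {0..L0})"
          using p s
          by (intro bounded_bilinear.has_vector_derivative[OF bounded_bilinear_inner] \<eta>_s) auto
        then show "((\<lambda>s. p s \<bullet> \<eta> s) has_vector_derivative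
            p s \<bullet> (\<eta>' s + strain L0 R s \<times> \<eta> s)) (at s within {0..L0})"
          by (simp add: cross_inner_assoc inner_add_right)
      qed (use L0 in simp)
      then have "integral {0..L0} (\<lambda>s. p s \<bullet> (\<eta>' s + strain L0 R s \<times> \<eta> s)) = 0"
        unfolding \<eta>_ends by (simp add: integral_unique)
      then show "((\<lambda>e. rod_energy K a T uh L0 (V e)) has_real_derivative 0) (at 0)"
        using energy_derivative by (simp add: p_def)
    qed
  qed
qed

section \<open>Left inverses and rank-one updates\<close>

text \<open>Unlike the inverse function theorems of the library, this does not require a local inverse
  of \<open>f\<close>: continuity of \<open>u\<close> suffices.\<close>

lemma has_vector_derivative_of_left_inverse:
  fixes u :: "real \<Rightarrow> 'a::real_normed_vector" and f :: "'a \<Rightarrow> 'b::real_normed_vector"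
  assumes f: "(f has_derivative f') (at (u s))"
    and g: "bounded_linear g" and gf: "\<And>h. g (f' h) = h"
    and cont: "continuous (at s within S) u"
    and fu: "((\<lambda>t. f (u t)) has_vector_derivative q) (at s within S)"
  shows "(u has_vector_derivative g q) (at s within S)"
  unfolding has_vector_derivative_def has_derivative_within_alt
proof (intro conjI allI impI)
  show "bounded_linear (\<lambda>h. h *\<^sub>R g q)"
    by (rule bounded_linear_scaleR_left)
  interpret g: bounded_linear g by (rule g)
  obtain B where B: "0 < B" "\<And>x. norm (g x) \<le> norm x * B"
    using g.pos_bounded by blast
  fix e :: real assume e: "0 < e"
  \<comment> \<open>Let \<open>D = u t - u s\<close> and \<open>\<tau> = norm (t - s)\<close>. The
    remainder will be at most \<open>B * k * (\<tau> + norm D)\<close>. The bound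
    \<open>B * k \<le> 1 / 2\<close> lets \<open>norm D\<close> be absorbed, giving
    \<open>\<tau> + norm D \<le> c * \<tau>\<close>; then \<open>B * k * c \<le> e\<close>
    concludes.\<close>
  define c where "c = 2 * norm (g q) + 2"
  have c: "0 < c"
    unfolding c_def using norm_ge_zero[of "g q"] by linarith
  define k where "k = min (1 / (2 * B)) (e / (B * c))"
  have k: "0 < k" "B * k \<le> 1 / 2" "B * k * c \<le> e"
  proof -
    show "0 < k" using B c e by (simp add: k_def)
    have "k \<le> 1 / (2 * B)" "k \<le> e / (B * c)" by (simp_all add: k_def)
    then show "B * k \<le> 1 / 2" "B * k * c \<le> e"
      using B c by (simp_all add: field_simps)
  qed
  obtain d1 where d1: "0 < d1"
    "\<And>y. norm (y - u s) < d1 \<Longrightarrow> norm (f y - f (u s) - f' (y - u s)) \<le> k * norm (y - u s)"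
    using f k(1) unfolding has_derivative_at_alt by blast
  obtain d2 where d2: "0 < d2"
    "\<And>t. t \<in> S \<Longrightarrow> norm (t - s) < d2 \<Longrightarrow>
      norm (f (u t) - f (u s) - (t - s) *\<^sub>R q) \<le> k * norm (t - s)"
    using fu k(1) unfolding has_vector_derivative_def has_derivative_within_alt by blast
  obtain d3 where d3: "0 < d3" "\<And>t. t \<in> S \<Longrightarrow> norm (t - s) < d3 \<Longrightarrow> norm (u t - u s) < d1"
    using cont d1(1) unfolding continuous_within_eps_delta dist_norm by blast
  show "\<exists>d>0. \<forall>t\<in>S. norm (t - s) < d \<longrightarrow>
      norm (u t - u s - (t - s) *\<^sub>R g q) \<le> e * norm (t - s)"
  proof (intro exI[of _ "min d2 d3"] conjI ballI impI)
    fix t assume t: "t \<in> S" "norm (t - s) < min d2 d3"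
    let ?D = "u t - u s" and ?\<tau> = "norm (t - s)"
    \<comment> \<open>Difference of the two linearisation errors: the increments of \<open>f\<close>
      cancel and leave \<open>f' ?D - (t - s) *\<^sub>R q\<close>, on which \<open>g\<close> undoes
      \<open>f'\<close>.\<close>
    let ?X = "(f (u t) - f (u s) - (t - s) *\<^sub>R q) - (f (u t) - f (u s) - f' ?D)"
    have diff: "?D - (t - s) *\<^sub>R g q = g ?X"
      by (simp add: g.diff g.scaleR gf)
    have "norm ?X \<le> k * ?\<tau> + k * norm ?D"
      using d2(2)[of t] d1(2)[of "u t"] d3(2)[of t] t
        norm_triangle_ineq4[of "f (u t) - f (u s) - (t - s) *\<^sub>R q" "f (u t) - f (u s) - f' ?D"]
      by simp
    then have "norm ?X * B \<le> (k * ?\<tau> + k * norm ?D) * B"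
      using B(1) by (intro mult_right_mono) auto
    then have "norm (?D - (t - s) *\<^sub>R g q) \<le> (k * ?\<tau> + k * norm ?D) * B"
      unfolding diff by (rule order_trans[OF B(2)])
    then have est: "norm (?D - (t - s) *\<^sub>R g q) \<le> B * k * (?\<tau> + norm ?D)"
      by (simp add: algebra_simps)
    have "norm ?D \<le> norm (?D - (t - s) *\<^sub>R g q) + norm ((t - s) *\<^sub>R g q)"
      using norm_triangle_ineq[of "?D - (t - s) *\<^sub>R g q" "(t - s) *\<^sub>R g q"] by simp
    also have "\<dots> \<le> 1 / 2 * (?\<tau> + norm ?D) + ?\<tau> * norm (g q)"
      using est mult_right_mono[OF k(2), of "?\<tau> + norm ?D"] by simp
    finally have "?\<tau> + norm ?D \<le> c * ?\<tau>"
      by (simp add: c_def algebra_simps)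
    then have "B * k * (?\<tau> + norm ?D) \<le> B * k * (c * ?\<tau>)"
      using B(1) k(1) by (intro mult_left_mono) auto
    also have "\<dots> = (B * k * c) * ?\<tau>"
      by simp
    also have "\<dots> \<le> e * ?\<tau>"
      using k(3) by (rule mult_right_mono) simp
    finally show "norm (?D - (t - s) *\<^sub>R g q) \<le> e * ?\<tau>"
      using est by linarith
  qed (use d2 d3 in simp)
qed

section \<open>Algebra of rank-one perturbations of the identity\<close>

lemma outer_mult_outer: "outer x y ** outer z w = (y \<bullet> z) *\<^sub>R outer x w"
  by (simp add: outer_def matrix_matrix_mult_def vec_eq_iff inner_vec_def sum_distrib_left
      sum_distrib_right mult_ac)

text \<open>\<open>matrix_inv\<close> is a Hilbert choice; uniqueness of two-sided inverses pins it
  down.\<close>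

lemma matrix_inv_eqI:
  assumes "A ** B = mat 1" "B ** A = mat 1"
  shows "matrix_inv A = B"
proof -
  have "A ** matrix_inv A = mat 1 \<and> matrix_inv A ** A = mat 1"
    unfolding matrix_inv_def by (rule someI) (use assms in blast)
  then show ?thesis
    by (metis assms(2) matrix_mul_assoc matrix_mul_lid matrix_mul_rid)
qed

text \<open>Matrices \<open>mat 1 + b *\<^sub>R outer x y\<close> are closed under multiplication,
  coefficients \<open>b\<close> and \<open>d\<close> composing to
  \<open>b + d + b * d * (y \<bullet> x)\<close>. The coefficient \<open>- k\<close> is the one that
  composes with \<open>c\<close> to 0.\<close>

lemma Sherman_Morrison:
  assumes "1 + c * (y \<bullet> x) \<noteq> 0"
  shows "invertible (mat 1 + c *\<^sub>R outer x y)"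
    and "matrix_inv (mat 1 + c *\<^sub>R outer x y) = mat 1 - (c / (1 + c * (y \<bullet> x))) *\<^sub>R outer x y"
proof -
  interpret mm: bounded_bilinear "(**) :: real^3^3 \<Rightarrow> real^3^3 \<Rightarrow> real^3^3"
    by (rule bounded_bilinear_matrix_matrix_mult)
  let ?M = "mat 1 + c *\<^sub>R outer x y"
  define k where "k = c / (1 + c * (y \<bullet> x))"
  let ?N = "mat 1 - k *\<^sub>R outer x y"
  have "c - k - c * k * (y \<bullet> x) = 0"
    using assms by (simp add: k_def field_simps)
  then have k: "c + (- k) + c * (- k) * (y \<bullet> x) = 0" "(- k) + c + (- k) * c * (y \<bullet> x) = 0"
    by (simp_all add: algebra_simps)
  have prod: "(mat 1 + b *\<^sub>R outer x y) ** (mat 1 + d *\<^sub>R outer x y) =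
      mat 1 + (b + d + b * d * (y \<bullet> x)) *\<^sub>R outer x y" for b d
    by (simp add: mm.add_left mm.add_right mm.scaleR_left mm.scaleR_right outer_mult_outer
        algebra_simps)
  have "?M ** ?N = mat 1" "?N ** ?M = mat 1"
    using prod[of c "- k"] prod[of "- k" c] unfolding k by simp_all
  then show "invertible ?M"
    "matrix_inv ?M = mat 1 - (c / (1 + c * (y \<bullet> x))) *\<^sub>R outer x y"
    using matrix_inv_eqI by (auto simp: invertible_def k_def)
qed

section \<open>Diagonal stiffness\<close>

lemma matrix_mult_outer: "A ** outer x y = outer (A *v x) y"
  by (simp add: outer_def matrix_matrix_mult_def matrix_vector_mult_def vec_eq_iff
      sum_distrib_left sum_distrib_right mult_ac)

text \<open>Both sides determine \<open>y \<bullet> w\<close> by pairing with \<open>x\<close>, since \<open>x\<close> is a multiple of \<open>K\<^sup>-\<^sup>1 y\<close>.\<close>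

lemma rank_one_update_iff:
  fixes K :: "real^3^3" and x y q z w :: "real^3"
  assumes K: "\<And>w. x \<bullet> (K *v w) = k * (y \<bullet> w)"
    and nz: "k \<noteq> 0" "c \<noteq> 0" "k * c + x \<bullet> y \<noteq> 0"
  shows "K *v w + (y \<bullet> w / c) *\<^sub>R y = q + K *v z \<longleftrightarrow>
    K *v (w - z) = q - (((q + K *v z) \<bullet> x) / (k * c + x \<bullet> y)) *\<^sub>R y"
proof -
  \<comment> \<open>Absorbing \<open>K *v z\<close> into \<open>b\<close> reduces the claim to
    solving for \<open>K *v w\<close>; it is subtracted again at the end.\<close>
  define b where "b = q + K *v z"
  define D where "D = k * c + x \<bullet> y"
  have D: "D \<noteq> 0" using nz by (simp add: D_def)
  have "K *v w + (y \<bullet> w / c) *\<^sub>R y = b \<longleftrightarrow> K *v w = b - (b \<bullet> x / D) *\<^sub>R y"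
  proof
    assume eq: "K *v w + (y \<bullet> w / c) *\<^sub>R y = b"
    have "b \<bullet> x = k * (y \<bullet> w) + (y \<bullet> w / c) * (x \<bullet> y)"
      unfolding eq[symmetric] by (simp add: inner_commute[of _ x] inner_add_right K)
    also have "\<dots> = (y \<bullet> w / c) * D"
      using nz by (simp add: D_def field_simps)
    finally have "b \<bullet> x / D = y \<bullet> w / c"
      using D by simp
    then show "K *v w = b - (b \<bullet> x / D) *\<^sub>R y"
      unfolding eq[symmetric] by simp
  next
    assume eq: "K *v w = b - (b \<bullet> x / D) *\<^sub>R y"
    have "k * (y \<bullet> w) = b \<bullet> x - (b \<bullet> x / D) * (x \<bullet> y)"
      unfolding K[symmetric] eq by (simp add: inner_diff_right inner_commute[of x b])
    also have "\<dots> = k * (c * (b \<bullet> x / D))"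
      using D by (simp add: D_def field_simps)
    finally have "y \<bullet> w = c * (b \<bullet> x / D)"
      using nz(1) by (simp only: mult_cancel_left simp_thms)
    then have "y \<bullet> w / c = b \<bullet> x / D"
      using nz(2) by simp
    then show "K *v w + (y \<bullet> w / c) *\<^sub>R y = b"
      by (simp add: eq)
  qed
  also have "\<dots> \<longleftrightarrow> K *v (w - z) = q - (b \<bullet> x / D) *\<^sub>R y"
    by (auto simp: b_def matrix_vector_mult_diff_distrib algebra_simps)
  finally show ?thesis
    by (simp add: b_def D_def)
qed

locale diagonal_stiffness =
  fixes K :: "real^3^3"
  assumes K_diagonal: "\<And>i j. i \<noteq> j \<Longrightarrow> K $ i $ j = 0"
    and K_pos_def: "\<And>v. v \<noteq> 0 \<Longrightarrow> 0 < v \<bullet> (K *v v)"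
begin

lemma K_sym: "transpose K = K"
  by (simp add: vec_eq_iff transpose_def) (metis K_diagonal)

lemma K_mult_vec: "(K *v v) $ i = K $ i $ i * v $ i"
proof -
  have "(K *v v) $ i = (\<Sum>j\<in>UNIV. if j = i then K $ i $ i * v $ i else 0)"
    unfolding matrix_vector_mult_def vec_lambda_beta by (rule sum.cong) (auto simp: K_diagonal)
  then show ?thesis
    by simp
qed

lemma K_pos: "0 < K $ i $ i"
  using K_pos_def[of "axis i 1"] by (simp add: inner_axis' K_mult_vec axis_eq_0_iff)

lemma K_inverse: "K *v (matrix_inv K *v v) = v" "matrix_inv K *v (K *v v) = v"
  "(matrix_inv K *v v) $ i = v $ i / K $ i $ i"
proof -
  define J where "J = (\<chi> i j. if i = j then 1 / K $ i $ i else 0)"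
  have J: "(J *v v) $ i = v $ i / K $ i $ i" for v i
    by (simp add: J_def matrix_vector_mult_def if_distrib[of "\<lambda>c. c * _"] cong: if_cong)
  have KJ: "K *v (J *v v) = v" and JK: "J *v (K *v v) = v" for v
    using K_pos by (simp_all add: vec_eq_iff J K_mult_vec less_imp_neq[THEN not_sym])
  have "matrix_inv K = J"
    using KJ JK by (intro matrix_inv_eqI) (simp_all add: matrix_eq flip: matrix_vector_mul_assoc)
  then show "K *v (matrix_inv K *v v) = v" "matrix_inv K *v (K *v v) = v"
    "(matrix_inv K *v v) $ i = v $ i / K $ i $ i"
    using J KJ JK by simp_all
qed

section \<open>The rank-one tendon Hessian combined with a diagonal stiffness\<close>

context
  fixes a T :: real and u l x y :: "real^3"
  assumes T: "0 < T" and u: "0 < tendon_length a u"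
  defines "l \<equiv> lvec a T u" and "x \<equiv> d1 \<times> (K *v l)" and "y \<equiv> d1 \<times> l"
begin

text \<open>Crossing with \<open>d1\<close> is an isometry of the plane orthogonal to
  \<open>d1\<close>, in which both \<open>l\<close> and \<open>K *v l\<close> lie.\<close>

lemma x_inner_y: "x \<bullet> y = l \<bullet> (K *v l)"
proof -
  have "l $ 1 = 0"
    by (simp add: l_def)
  then show ?thesis
    by (simp add: x_def y_def inner_vec_def sum_3 K_mult_vec)
qed

text \<open>Crossing with \<open>d1\<close> interchanges the second and third slots, so for diagonal
  \<open>K\<close> the vector \<open>x\<close> is \<open>K $ 2 $ 2 * K $ 3 $ 3\<close> times the
  inverse of \<open>K\<close> applied to \<open>y\<close>.\<close>

lemma x_inner_K: "x \<bullet> (K *v w) = K $ 2 $ 2 * K $ 3 $ 3 * (y \<bullet> w)"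
  by (simp add: x_def y_def inner_vec_def sum_3 K_mult_vec algebra_simps)

lemma denominator_pos:
  "0 < K $ 2 $ 2 * K $ 3 $ 3 * lagr1 a T u" "0 < lagr1 a T u"
  "0 < K $ 2 $ 2 * K $ 3 $ 3 * lagr1 a T u + l \<bullet> (K *v l)"
proof -
  show l1: "0 < lagr1 a T u"
    using T u by (simp add: lagr1_def)
  then show pos: "0 < K $ 2 $ 2 * K $ 3 $ 3 * lagr1 a T u"
    using K_pos by simp
  have "0 \<le> l \<bullet> (K *v l)"
    using K_pos_def[of l] by (cases "l = 0") auto
  with pos show "0 < K $ 2 $ 2 * K $ 3 $ 3 * lagr1 a T u + l \<bullet> (K *v l)"
    by linarith
qed

lemma compliance_hessian:
  "matrix_inv K ** hessian (lagr1 a T) u =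
    (1 / (K $ 2 $ 2 * K $ 3 $ 3 * lagr1 a T u)) *\<^sub>R outer x y"
proof -
  have "matrix_inv K *v y = (1 / (K $ 2 $ 2 * K $ 3 $ 3)) *\<^sub>R x"
    using K_pos[of 2] K_pos[of 3]
    by (simp add: vec_eq_iff forall_3 K_inverse K_mult_vec x_def y_def)
  moreover have "matrix_inv K ** hessian (lagr1 a T) u = (1 / lagr1 a T u) *\<^sub>R outer (matrix_inv K *v y) y"
    using T hessian_lagr1[OF u, of T] unfolding y_def l_def
    by (simp add: matrix_mult_outer bounded_bilinear.scaleR_right[OF bounded_bilinear_matrix_matrix_mult])
  ultimately show ?thesis
    by (simp add: outer_def vec_eq_iff)
qed

text \<open>Sherman-Morrison with \<open>c = 1 / A\<close> and \<open>y \<bullet> x = S\<close>,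
  where the coefficient simplifies to \<open>1 / (A + S)\<close>.\<close>

lemma inverse_formula:
  "invertible (mat 1 + matrix_inv K ** hessian (lagr1 a T) u)"
  "matrix_inv (mat 1 + matrix_inv K ** hessian (lagr1 a T) u) =
    mat 1 - (1 / (K $ 2 $ 2 * K $ 3 $ 3 * lagr1 a T u + l \<bullet> (K *v l))) *\<^sub>R outer x y"
proof -
  define A S where "A = K $ 2 $ 2 * K $ 3 $ 3 * lagr1 a T u" and "S = l \<bullet> (K *v l)"
  have pos: "0 < A" "0 < A + S"
    using denominator_pos by (simp_all add: A_def S_def)
  have S: "y \<bullet> x = S"
    using x_inner_y by (simp add: S_def inner_commute)
  have nz: "1 + 1 / A * (y \<bullet> x) \<noteq> 0"
    and coeff: "(1 / A) / (1 + 1 / A * (y \<bullet> x)) = 1 / (A + S)"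
    unfolding S using pos by (simp_all add: field_simps)
  show "invertible (mat 1 + matrix_inv K ** hessian (lagr1 a T) u)"
    unfolding compliance_hessian A_def[symmetric] by (rule Sherman_Morrison(1)[OF nz])
  show "matrix_inv (mat 1 + matrix_inv K ** hessian (lagr1 a T) u) =
    mat 1 - (1 / (K $ 2 $ 2 * K $ 3 $ 3 * lagr1 a T u + l \<bullet> (K *v l))) *\<^sub>R outer x y"
    unfolding compliance_hessian A_def[symmetric] S_def[symmetric]
    by (rule Sherman_Morrison(2)[OF nz, unfolded coeff])
qed

text \<open>Used with \<open>w = u'\<close>, \<open>z = uh'\<close> and
  \<open>q = p \<times> u\<close>: the left side is the Hamel equation with \<open>u'\<close>
  appearing implicitly, the right side the same equation solved for
  \<open>m' = K *v (u' - uh')\<close>.\<close>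

lemma moment_equation_iff:
  "K *v w + (y \<bullet> w / lagr1 a T u) *\<^sub>R y = q + K *v z \<longleftrightarrow>
    K *v (w - z) = q - (((q + K *v z) \<bullet> x) /
      (K $ 2 $ 2 * K $ 3 $ 3 * lagr1 a T u + l \<bullet> (K *v l))) *\<^sub>R y"
  using rank_one_update_iff[OF x_inner_K] denominator_pos K_pos[of 2] K_pos[of 3]
  by (simp flip: x_inner_y)

lemma momentum_map_has_derivative:
  "((\<lambda>v. K *v v + lvec a T v) has_derivative (\<lambda>h. K *v h + (y \<bullet> h / lagr1 a T u) *\<^sub>R y)) (at u)"
  unfolding y_def l_def
  using T u
  by (intro has_derivative_add lvec_has_derivative
      bounded_linear_imp_has_derivative matrix_vector_mul_bounded_linear) auto

text \<open>The tendon Hessian is positive semidefinite, so the derivative of the momentum map is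
  positive definite.\<close>

lemma momentum_map_left_inverse:
  obtains g where "bounded_linear g" "\<And>h. g (K *v h + (y \<bullet> h / lagr1 a T u) *\<^sub>R y) = h"
proof -
  let ?f = "\<lambda>h. K *v h + (y \<bullet> h / lagr1 a T u) *\<^sub>R y"
  have lin: "linear ?f"
    using has_derivative_bounded_linear[OF momentum_map_has_derivative]
    by (rule bounded_linear.linear)
  have "h = 0" if "?f h = 0" for h
  proof (rule ccontr)
    assume "h \<noteq> 0"
    then have "0 < h \<bullet> (K *v h) + (y \<bullet> h) * (y \<bullet> h) / lagr1 a T u"
      using denominator_pos(2) by (intro add_pos_nonneg K_pos_def) simp_all
    also have "\<dots> = h \<bullet> ?f h"
      by (simp add: inner_add_right inner_commute)
    finally show False
      using that by simp
  qed
  then have "inj ?f"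
    using linear_injective_0[OF lin] by blast
  then obtain g where "linear g" "g \<circ> ?f = id"
    using linear_injective_left_inverse[OF lin] by blast
  then show ?thesis
    using that by (simp add: linear_conv_bounded_linear o_def fun_eq_iff)
qed

end

section \<open>The equations of the rod\<close>

text \<open>The law \<open>m = K *v (u - uh)\<close> stands on the left because
  \<open>rod_system\<close> contains it implicitly: its \<open>u\<close> is built from
  \<open>m\<close>, and \<open>R' = R ** hat u\<close> forces that \<open>u\<close> to be the
  strain.\<close>

lemma hamel_iff_rod_system:
  assumes L0: "0 < L0" and T: "0 < T" and rod: "rod_curve a L0 R"
    and uh: "\<And>s. s \<in> {0..L0} \<Longrightarrow> (uh has_vector_derivative uh' s) (at s within {0..L0})"
  shows "hamel_equations K a T uh L0 R \<and> (\<forall>s\<in>{0..L0}. m s = K *v (strain L0 R s - uh s)) \<longleftrightarrow>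
    rod_system K a T uh L0 R m"
proof -
  let ?I = "{0..L0}"
  define u where "u = strain L0 R"
  define l x y where "l s = lvec a T (u s)" and "x s = d1 \<times> (K *v l s)" and "y s = d1 \<times> l s" for s
  define p where "p s = K *v (u s - uh s) + l s" for s
  define D where "D s = K $ 2 $ 2 * K $ 3 $ 3 * lagr1 a T (u s) + l s \<bullet> (K *v l s)" for s
  define \<Phi> where "\<Phi> v = K *v v + lvec a T v" for v
  have pos: "0 < tendon_length a (u s)" if "s \<in> ?I" for s
    using rod that by (simp add: rod_curve_def u_def)
  have u_R: "(R has_vector_derivative R s ** hat (u s)) (at s within ?I)" if "s \<in> ?I" for s
    unfolding u_def by (rule strain_of_rod_curve(1)[OF L0 rod that])
  have u_cont: "continuous_on ?I u"
    unfolding u_def by (rule strain_of_rod_curve(2)[OF L0 rod])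
  have hamel: "hamel_equations K a T uh L0 R \<longleftrightarrow>
      (\<forall>s\<in>?I. (p has_vector_derivative p s \<times> u s) (at s within ?I))"
    using hamel_equations_iff[OF K_sym rod, of T uh]
    unfolding p_def[abs_def] momentum_def l_def u_def .
  have K_deriv: "((\<lambda>s. K *v f s) has_vector_derivative K *v f') (at s within S)"
    if "(f has_vector_derivative f') (at s within S)" for f f' s S
    by (rule bounded_linear.has_vector_derivative[OF matrix_vector_mul_bounded_linear that])
  have uh'_eq: "vector_derivative uh (at s within ?I) = uh' s" if "s \<in> ?I" for s
    by (rule vector_derivative_within_closed_interval[OF L0 that uh[OF that]])
  have \<Phi>_deriv: "((\<lambda>s. \<Phi> (u s)) has_vector_derivative
      K *v u' + (y s \<bullet> u' / lagr1 a T (u s)) *\<^sub>R y s) (at s within ?I)"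
    if s: "s \<in> ?I" and u': "(u has_vector_derivative u') (at s within ?I)" for s u'
  proof -
    have "(\<Phi> has_derivative (\<lambda>h. K *v h + (y s \<bullet> h / lagr1 a T (u s)) *\<^sub>R y s)) (at (u s))"
      unfolding \<Phi>_def[abs_def] y_def l_def by (rule momentum_map_has_derivative[OF T pos[OF s]])
    from has_derivative_compose[OF u'[unfolded has_vector_derivative_def] this]
    show ?thesis
      by (simp add: has_vector_derivative_def matrix_vector_mult_scaleR scaleR_add_right)
  qed
  have p_\<Phi>: "\<Phi> (u s) = p s + K *v uh s" "p s = \<Phi> (u s) - K *v uh s" for s
    by (simp_all add: \<Phi>_def p_def l_def matrix_vector_mult_diff_distrib)
  have moment_iff: "K *v w + (y s \<bullet> w / lagr1 a T (u s)) *\<^sub>R y s = q + K *v z \<longleftrightarrow>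
      K *v (w - z) = q - (((q + K *v z) \<bullet> x s) / D s) *\<^sub>R y s" if "s \<in> ?I" for s w q z
    unfolding x_def y_def l_def D_def by (rule moment_equation_iff[OF T pos[OF that]])
  have rod_eq_iff: "m' + u s \<times> v = l s \<times> u s - c *\<^sub>R y s \<longleftrightarrow>
      m' = (v + l s) \<times> u s - c *\<^sub>R y s" for m' v c s
    by (auto simp: cross_add_left cross_skew[of "u s" v] algebra_simps)
  show ?thesis
  proof (intro iffI)
    assume "hamel_equations K a T uh L0 R \<and> (\<forall>s\<in>?I. m s = K *v (strain L0 R s - uh s))"
    then have p: "\<And>s. s \<in> ?I \<Longrightarrow> (p has_vector_derivative p s \<times> u s) (at s within ?I)"
      and m: "\<And>s. s \<in> ?I \<Longrightarrow> m s = K *v (u s - uh s)"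
      unfolding hamel u_def by auto
    show "rod_system K a T uh L0 R m"
      unfolding rod_system_def Let_def
    proof
      fix s assume s: "s \<in> ?I"
      have u_m: "uh s + matrix_inv K *v m s = u s"
        by (simp add: m[OF s] K_inverse)
      have \<Phi>: "((\<lambda>s. \<Phi> (u s)) has_vector_derivative p s \<times> u s + K *v uh' s) (at s within ?I)"
        unfolding p_\<Phi>(1) by (intro has_vector_derivative_add p K_deriv uh s)
      obtain g where g: "bounded_linear g"
        "\<And>h. g (K *v h + (y s \<bullet> h / lagr1 a T (u s)) *\<^sub>R y s) = h"
        unfolding y_def l_def using momentum_map_left_inverse[OF T pos[OF s]] by blast
      \<comment> \<open>The only candidate: the derivative of \<open>\<Phi>\<close> at
        \<open>u s\<close> must send \<open>u'\<close> to the derivative of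
        \<open>\<Phi> (u s)\<close>, and \<open>g\<close> inverts it from the left.\<close>
      define u' where "u' = g (p s \<times> u s + K *v uh' s)"
      have u': "(u has_vector_derivative u') (at s within ?I)"
        unfolding u'_def
      proof (rule has_vector_derivative_of_left_inverse[OF _ g])
        show "(\<Phi> has_derivative (\<lambda>h. K *v h + (y s \<bullet> h / lagr1 a T (u s)) *\<^sub>R y s)) (at (u s))"
          unfolding \<Phi>_def[abs_def] y_def l_def by (rule momentum_map_has_derivative[OF T pos[OF s]])
        show "continuous (at s within ?I) u"
          using u_cont s by (simp add: continuous_on_eq_continuous_within)
      qed (rule \<Phi>)
      \<comment> \<open>The derivative of \<open>\<Phi> (u s)\<close>, computed once by the chain
        rule and once from the Hamel equation.\<close>
      have "K *v u' + (y s \<bullet> u' / lagr1 a T (u s)) *\<^sub>R y s = p s \<times> u s + K *v uh' s"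
        by (rule vector_derivative_unique_within[OF at_within_Icc_neq_bot[OF L0 s]
              \<Phi>_deriv[OF s u'] \<Phi>])
      then have eq: "K *v (u' - uh' s) =
          (m s + l s) \<times> u s - ((((m s + l s) \<times> u s + K *v uh' s) \<bullet> x s) / D s) *\<^sub>R y s"
        unfolding moment_iff[OF s] by (simp add: p_def m[OF s])
      have "((\<lambda>s. K *v (u s - uh s)) has_vector_derivative K *v (u' - uh' s)) (at s within ?I)"
        by (intro K_deriv has_vector_derivative_diff u' uh s)
      then have m': "(m has_vector_derivative K *v (u' - uh' s)) (at s within ?I)"
        by (rule has_vector_derivative_transform[OF s, rotated]) (simp add: m)
      show "(R has_vector_derivative R s ** hat (uh s + matrix_inv K *v m s)) (at s within ?I) \<and>
        (\<exists>m'. (m has_vector_derivative m') (at s within ?I) \<and>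
          m' + (uh s + matrix_inv K *v m s) \<times> m s =
            lvec a T (uh s + matrix_inv K *v m s) \<times> (uh s + matrix_inv K *v m s) -
            ((((m s + lvec a T (uh s + matrix_inv K *v m s)) \<times> (uh s + matrix_inv K *v m s) +
                K *v vector_derivative uh (at s within ?I)) \<bullet>
                (d1 \<times> (K *v lvec a T (uh s + matrix_inv K *v m s)))) /
              (K $ 2 $ 2 * K $ 3 $ 3 * lagr1 a T (uh s + matrix_inv K *v m s) +
                lvec a T (uh s + matrix_inv K *v m s) \<bullet>
                (K *v lvec a T (uh s + matrix_inv K *v m s)))) *\<^sub>R
              (d1 \<times> lvec a T (uh s + matrix_inv K *v m s)))"
        unfolding u_m uh'_eq[OF s] l_def[symmetric] x_def[symmetric] y_def[symmetric]
          D_def[symmetric] rod_eq_iff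
        using u_R[OF s] m' eq by blast
    qed
  next
    assume sys: "rod_system K a T uh L0 R m"
    have u_m: "uh s + matrix_inv K *v m s = u s" if s: "s \<in> ?I" for s
    proof -
      have "orthogonal_matrix (R s)"
        using rod s by (simp add: rod_curve_def rotation_matrix_def)
      then show ?thesis
        using sys s unfolding u_def rod_system_def Let_def
        by (intro strain_unique[symmetric] L0 s) auto
    qed
    have m: "m s = K *v (u s - uh s)" if s: "s \<in> ?I" for s
      using K_inverse(1)[of "m s"] by (simp flip: u_m[OF s])
    have "(p has_vector_derivative p s \<times> u s) (at s within ?I)" if s: "s \<in> ?I" for s
    proof -
      obtain m' where m': "(m has_vector_derivative m') (at s within ?I)"
        and "m' + u s \<times> m s = l s \<times> u s -
          ((((m s + l s) \<times> u s + K *v uh' s) \<bullet> x s) / D s) *\<^sub>R y s"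
        using bspec[OF sys[unfolded rod_system_def Let_def] s]
        unfolding u_m[OF s] uh'_eq[OF s] l_def x_def y_def D_def by blast
      then have eq: "m' = p s \<times> u s - (((p s \<times> u s + K *v uh' s) \<bullet> x s) / D s) *\<^sub>R y s"
        unfolding rod_eq_iff by (simp add: p_def m[OF s])
      \<comment> \<open>In this direction \<open>u\<close> is differentiable at once, being
        \<open>uh + matrix_inv K *v m\<close> on the interval.\<close>
      define u' where "u' = uh' s + matrix_inv K *v m'"
      have "((\<lambda>s. uh s + matrix_inv K *v m s) has_vector_derivative u') (at s within ?I)"
        unfolding u'_def
        by (intro has_vector_derivative_add uh s m'
            bounded_linear.has_vector_derivative[OF matrix_vector_mul_bounded_linear])
      then have u': "(u has_vector_derivative u') (at s within ?I)"
        by (rule has_vector_derivative_transform[OF s, rotated]) (simp add: u_m)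
      have "K *v (u' - uh' s) = m'"
        by (simp add: u'_def K_inverse)
      then have "K *v u' + (y s \<bullet> u' / lagr1 a T (u s)) *\<^sub>R y s = p s \<times> u s + K *v uh' s"
        unfolding moment_iff[OF s] using eq by simp
      then have "((\<lambda>s. \<Phi> (u s) - K *v uh s) has_vector_derivative
          (p s \<times> u s + K *v uh' s) - K *v uh' s) (at s within ?I)"
        using \<Phi>_deriv[OF s u'] by (intro has_vector_derivative_diff K_deriv uh s) simp
      then show ?thesis
        unfolding p_\<Phi>(2)[symmetric] by simp
    qed
    then show "hamel_equations K a T uh L0 R \<and> (\<forall>s\<in>?I. m s = K *v (strain L0 R s - uh s))"
      using m unfolding hamel u_def by blast
  qed
qed

end

section \<open>The inversion formula together with the three descriptions of equilibrium\<close>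

theorem mainTheorem4:
  fixes K :: "real^3^3" and a T L0 :: real and uh :: "real \<Rightarrow> real^3"
  assumes K_diagonal: "\<And>i j. i \<noteq> j \<Longrightarrow> K $ i $ j = 0"
    and K_pos_def: "\<And>v. v \<noteq> 0 \<Longrightarrow> 0 < v \<bullet> (K *v v)"
    and a_pos: "0 < a" and T_pos: "0 < T" and L0_pos: "0 < L0"
    and uh_smooth: "smooth_curve_on {0..L0} uh"
  shows
    "(\<forall>u. tendon_length a u > 0 \<longrightarrow>
        (let l = lvec a T u; L = hessian (lagr1 a T) u in
           invertible (mat 1 + matrix_inv K ** L) \<and>
           matrix_inv (mat 1 + matrix_inv K ** L) =
             mat 1 - (1 / (K $ 2 $ 2 * K $ 3 $ 3 * lagr1 a T u + l \<bullet> (K *v l))) *\<^sub>R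
                       outer (d1 \<times> (K *v l)) (d1 \<times> l))) \<and>
     (\<forall>R. rod_curve a L0 R \<longrightarrow>
        (critical_curve K a T uh L0 R \<longleftrightarrow> hamel_equations K a T uh L0 R) \<and>
        (\<forall>m. (critical_curve K a T uh L0 R \<and>
                (\<forall>s\<in>{0..L0}. m s = K *v (strain L0 R s - uh s)))
             \<longleftrightarrow> rod_system K a T uh L0 R m))"
proof -
  interpret diagonal_stiffness K
    using K_diagonal K_pos_def by unfold_locales
  have "Ck_on (Suc 0) {0..L0} uh"
    using uh_smooth unfolding smooth_curve_on_def by blast
  then obtain uh' where
    uh': "\<And>s. s \<in> {0..L0} \<Longrightarrow> (uh has_vector_derivative uh' s) (at s within {0..L0})"
    unfolding Ck_on.simps by blast
  then have uh_cont: "continuous_on {0..L0} uh"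
    by (rule continuous_on_vector_derivative)
  show ?thesis
    using inverse_formula[OF T_pos]
      critical_iff_hamel[OF L0_pos K_sym uh_cont, of a _ T]
      hamel_iff_rod_system[OF L0_pos T_pos _ uh', of a]
    by (simp add: Let_def)
qed

end
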